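(* Let $K$ be a field and $v:K\to\Gamma\cup\{\infty\}$ a surjective valuation. Let $A$ be a graded $K$-algebra with a finite PBW-basis and let $\Lambda=\pi(O_v\langle \underline X\rangle)\subset A$. (i) If $\overline\Lambda=\Lambda/m_v\Lambda$ is a domain and $A$ is an Ore domain, then the valuation $v$ on $K$ extends to $Q=Q_{cl}(A)$, the classical ring of fractions of $A$. (ii) If $\Lambda$ defines a good reduction of $A$, $A(k_v)$ is a domain and $A$ is an Ore domain, then the valuation $v$ on $K$ extends to $Q$.
   Context: $\Gamma$ is a totally ordered group (commutative, since $v$ is surjective), $O_v$ is the valuation ring of $v$, $m_v$ its maximal ideal, $k_v=O_v/m_v$ the residue field. $A$ is a $K$-algebra generated by $a_1,\dots,a_n$; having a finite PBW-basis on these generators means that the ordered monomials $a_1^{e_1}\cdots a_n^{e_n}$ ($e_i\in\mathbb N$) form a $K$-basis of $A$. $K\langle\underline X\rangle$ is the free $K$-algebra on $\underline X=\{X_1,\dots,X_n\}$, $\pi:K\langle\underline X\rangle\to A$ is the $K$-algebra morphism with $\pi(X_i)=a_i$, and $\Lambda=\pi(O_v\langle\underline X\rangle)$, a subring of $A$. Let $\mathcal R=\ker\pi$ be the ideal of relations, generated as a two-sided ideal by $p_1(\underline X),\dots,p_d(\underline X)$, chosen in $O_v\langle\underline X\rangle$ and not all in $m_v\langle\underline X\rangle$. Let $\overline{\mathcal R}$ be the image of $\mathcal R\cap O_v\langle\underline X\rangle$ in $k_v\langle\underline X\rangle$. $\Lambda$ defines a good reduction of $A$ if $\overline{\mathcal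 R}$ is generated as a two-sided ideal of $k_v\langle\underline X\rangle$ by the residues $\overline{p_1},\dots,\overline{p_d}$. $A(k_v)$ is the $k_v$-algebra defined by the same relations as $A$, i.e. $k_v\langle\underline X\rangle/(\overline{p_1},\dots,\overline{p_d})$. A valuation on a skewfield $Q$ with values in $\Gamma$ is a map $w:Q\to\Gamma\cup\{\infty\}$ with $w(x)=\infty$ iff $x=0$, $w(xy)=w(x)+w(y)$, $w(x+y)\ge\min\{w(x),w(y)\}$; $v$ extends to $Q$ if there is such a $w$ with $w|_K=v$.
   Formalization: "Graded" is taken to mean that A is graded by the natural numbers and that the generators a_1,…,a_n are homogeneous of positive degree; for arbitrary gradings (generators of degree 0 or inhomogeneous) the claim is false. *)

theory Defs
  imports "HOL-Algebra.Module" "HOL-Algebra.QuotRing" "HOL-Algebra.Generated_Groups"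
begin

datatype 'g with_infty = Fin 'g | Infty

instantiation with_infty :: (linordered_ab_group_add) "{zero, plus, linorder}"
begin

definition zero_with_infty :: "'a with_infty" where
  "0 = Fin 0"

fun plus_with_infty :: "'a with_infty \<Rightarrow> 'a with_infty \<Rightarrow> 'a with_infty" where
  "Fin x + Fin y = Fin (x + y)"
| "Fin x + Infty = Infty"
| "Infty + y = Infty"

fun less_eq_with_infty :: "'a with_infty \<Rightarrow> 'a with_infty \<Rightarrow> bool" where
  "Fin x \<le> Fin y \<longleftrightarrow> x \<le> y"
| "Infty \<le> Fin y \<longleftrightarrow> False"
| "x \<le> Infty \<longleftrightarrow> True"

definition less_with_infty :: "'a with_infty \<Rightarrow> 'a with_infty \<Rightarrow> bool" where
  "x < y \<longleftrightarrow> x \<le> y \<and> \<not> y \<le> (x :: 'a with_infty)"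

instance
proof
  fix x y z :: "'a with_infty"
  show "x < y \<longleftrightarrow> x \<le> y \<and> \<not> y \<le> x"
    by (rule less_with_infty_def)
  show "x \<le> x"
    by (cases x) auto
  show "x \<le> y \<Longrightarrow> y \<le> z \<Longrightarrow> x \<le> z"
    by (cases x; cases y; cases z) auto
  show "x \<le> y \<Longrightarrow> y \<le> x \<Longrightarrow> x = y"
    by (cases x; cases y) auto
  show "x \<le> y \<or> y \<le> x"
    by (cases x; cases y) auto
qed

end

text \<open>The locale \<open>domain\<close> of HOL-Algebra is restricted to commutative rings.\<close>

definition nc_domain :: "('a, 'm) ring_scheme \<Rightarrow> bool" where
  "nc_domain R \<longleftrightarrow> ring R \<and> \<one>\<^bsub>R\<^esub> \<noteq> \<zero>\<^bsub>R\<^esub> \<and>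
     (\<forall>x\<in>carrier R. \<forall>y\<in>carrier R. x \<otimes>\<^bsub>R\<^esub> y = \<zero>\<^bsub>R\<^esub> \<longrightarrow> x = \<zero>\<^bsub>R\<^esub> \<or> y = \<zero>\<^bsub>R\<^esub>)"

definition ore_domain :: "('a, 'm) ring_scheme \<Rightarrow> bool" where
  "ore_domain R \<longleftrightarrow> nc_domain R \<and>
     (\<forall>x \<in> carrier R - {\<zero>\<^bsub>R\<^esub>}. \<forall>y \<in> carrier R - {\<zero>\<^bsub>R\<^esub>}.
        (\<exists>r\<in>carrier R. \<exists>s\<in>carrier R. x \<otimes>\<^bsub>R\<^esub> r = y \<otimes>\<^bsub>R\<^esub> s \<and> x \<otimes>\<^bsub>R\<^esub> r \<noteq> \<zero>\<^bsub>R\<^esub>) \<and>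
        (\<exists>r\<in>carrier R. \<exists>s\<in>carrier R. r \<otimes>\<^bsub>R\<^esub> x = s \<otimes>\<^bsub>R\<^esub> y \<and> r \<otimes>\<^bsub>R\<^esub> x \<noteq> \<zero>\<^bsub>R\<^esub>))"

definition regular_elements :: "('a, 'm) ring_scheme \<Rightarrow> 'a set" where
  "regular_elements R = {s \<in> carrier R. \<forall>x\<in>carrier R.
     (s \<otimes>\<^bsub>R\<^esub> x = \<zero>\<^bsub>R\<^esub> \<longrightarrow> x = \<zero>\<^bsub>R\<^esub>) \<and> (x \<otimes>\<^bsub>R\<^esub> s = \<zero>\<^bsub>R\<^esub> \<longrightarrow> x = \<zero>\<^bsub>R\<^esub>)}"

text \<open>\<open>Q\<close>, with the embedding \<open>\<iota>\<close>, is a (two-sided) classical ring of fractions of \<open>R\<close>; this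
  determines \<open>(Q, \<iota>)\<close> up to a unique isomorphism under \<open>R\<close>.\<close>

definition classical_ring_of_fractions ::
    "('a, 'm) ring_scheme \<Rightarrow> ('q, 'l) ring_scheme \<Rightarrow> ('a \<Rightarrow> 'q) \<Rightarrow> bool" where
  "classical_ring_of_fractions R Q \<iota> \<longleftrightarrow>
     ring Q \<and> \<iota> \<in> ring_hom R Q \<and> inj_on \<iota> (carrier R) \<and>
     \<iota> ` regular_elements R \<subseteq> Units Q \<and>
     (\<forall>q\<in>carrier Q. \<exists>x\<in>carrier R. \<exists>s\<in>regular_elements R. q = \<iota> x \<otimes>\<^bsub>Q\<^esub> inv\<^bsub>Q\<^esub> (\<iota> s)) \<and>
     (\<forall>q\<in>carrier Q. \<exists>x\<in>carrier R. \<exists>s\<in>regular_elements R. q = inv\<^bsub>Q\<^esub> (\<iota> s) \<otimes>\<^bsub>Q\<^esub> \<iota> x)"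

definition ring_valuation ::
    "('a, 'm) ring_scheme \<Rightarrow> ('a \<Rightarrow> 'g::linordered_ab_group_add with_infty) \<Rightarrow> bool" where
  "ring_valuation R w \<longleftrightarrow>
     (\<forall>x\<in>carrier R. w x = Infty \<longleftrightarrow> x = \<zero>\<^bsub>R\<^esub>) \<and>
     (\<forall>x\<in>carrier R. \<forall>y\<in>carrier R. w (x \<otimes>\<^bsub>R\<^esub> y) = w x + w y) \<and>
     (\<forall>x\<in>carrier R. \<forall>y\<in>carrier R. min (w x) (w y) \<le> w (x \<oplus>\<^bsub>R\<^esub> y))"

definition valuation_ring ::
    "('k, 'm) ring_scheme \<Rightarrow> ('k \<Rightarrow> 'g::linordered_ab_group_add with_infty) \<Rightarrow> ('k, 'm) ring_scheme" where
  "valuation_ring K v = K\<lparr>carrier := {x \<in> carrier K. 0 \<le> v x}\<rparr>"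

definition max_ideal ::
    "('k, 'm) ring_scheme \<Rightarrow> ('k \<Rightarrow> 'g::linordered_ab_group_add with_infty) \<Rightarrow> 'k set" where
  "max_ideal K v = {x \<in> carrier K. 0 < v x}"

definition residue_field ::
    "('k, 'm) ring_scheme \<Rightarrow> ('k \<Rightarrow> 'g::linordered_ab_group_add with_infty) \<Rightarrow> 'k set ring" where
  "residue_field K v = valuation_ring K v Quot max_ideal K v"

text \<open>The free algebra over \<open>R\<close> on a set \<open>I\<close> of letters: a noncommutative polynomial is its
  coefficient function on words, and the product is the convolution over all factorizations of
  a word. The letter \<open>i\<close> itself is the indicator function of the word \<open>[i]\<close>.\<close>

definition free_algebra :: "('r, 'm) ring_scheme \<Rightarrow> 'x set \<Rightarrow> ('x list \<Rightarrow> 'r) ring" where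
  "free_algebra R I =
     \<lparr>carrier = {f. (\<forall>w. f w \<in> carrier R) \<and> finite {w. f w \<noteq> \<zero>\<^bsub>R\<^esub>} \<and> {w. f w \<noteq> \<zero>\<^bsub>R\<^esub>} \<subseteq> lists I},
      mult = (\<lambda>f g w. \<Oplus>\<^bsub>R\<^esub>i\<in>{..length w}. f (take i w) \<otimes>\<^bsub>R\<^esub> g (drop i w)),
      one = (\<lambda>w. if w = [] then \<one>\<^bsub>R\<^esub> else \<zero>\<^bsub>R\<^esub>),
      zero = (\<lambda>w. \<zero>\<^bsub>R\<^esub>),
      add = (\<lambda>f g w. f w \<oplus>\<^bsub>R\<^esub> g w)\<rparr>"

text \<open>The \<open>K\<close>-algebra morphism from the free algebra to \<open>A\<close> sending the letter \<open>i\<close> to \<open>a i\<close>.\<close>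

definition free_eval ::
    "('k, 'm) ring_scheme \<Rightarrow> ('k, 'a, 'l) module_scheme \<Rightarrow> ('x \<Rightarrow> 'a) \<Rightarrow> ('x list \<Rightarrow> 'k) \<Rightarrow> 'a" where
  "free_eval K A a f =
     (\<Oplus>\<^bsub>A\<^esub>w\<in>{w. f w \<noteq> \<zero>\<^bsub>K\<^esub>}. f w \<odot>\<^bsub>A\<^esub> foldr (\<lambda>i y. a i \<otimes>\<^bsub>A\<^esub> y) w \<one>\<^bsub>A\<^esub>)"

text \<open>The locale \<open>algebra\<close> of HOL-Algebra is restricted to commutative algebras.\<close>

definition nc_algebra :: "('k, 'm) ring_scheme \<Rightarrow> ('k, 'a, 'l) module_scheme \<Rightarrow> bool" where
  "nc_algebra K A \<longleftrightarrow> module K A \<and> ring A \<and>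
     (\<forall>c\<in>carrier K. \<forall>x\<in>carrier A. \<forall>y\<in>carrier A.
        (c \<odot>\<^bsub>A\<^esub> x) \<otimes>\<^bsub>A\<^esub> y = c \<odot>\<^bsub>A\<^esub> (x \<otimes>\<^bsub>A\<^esub> y) \<and> x \<otimes>\<^bsub>A\<^esub> (c \<odot>\<^bsub>A\<^esub> y) = c \<odot>\<^bsub>A\<^esub> (x \<otimes>\<^bsub>A\<^esub> y))"

text \<open>In \<open>algebra_grading\<close> and \<open>basis_family\<close>, finitely supported families \<open>c\<close> are total functions; sums
  range over the support, and unique existence of \<open>c\<close> encodes directness and linear independence.\<close>

definition algebra_grading ::
    "('k, 'm) ring_scheme \<Rightarrow> ('k, 'a, 'l) module_scheme \<Rightarrow> (nat \<Rightarrow> 'a set) \<Rightarrow> bool" where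
  "algebra_grading K A G \<longleftrightarrow>
     (\<forall>m. submodule (G m) K A) \<and>
     (\<forall>x\<in>carrier A. \<exists>!c. (\<forall>m. c m \<in> G m) \<and> finite {m. c m \<noteq> \<zero>\<^bsub>A\<^esub>} \<and>
        x = (\<Oplus>\<^bsub>A\<^esub>m\<in>{m. c m \<noteq> \<zero>\<^bsub>A\<^esub>}. c m)) \<and>
     \<one>\<^bsub>A\<^esub> \<in> G 0 \<and>
     (\<forall>l m. \<forall>x\<in>G l. \<forall>y\<in>G m. x \<otimes>\<^bsub>A\<^esub> y \<in> G (l + m))"

definition basis_family ::
    "('k, 'm) ring_scheme \<Rightarrow> ('k, 'a, 'l) module_scheme \<Rightarrow> 'e set \<Rightarrow> ('e \<Rightarrow> 'a) \<Rightarrow> bool" where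
  "basis_family K A E b \<longleftrightarrow> b \<in> E \<rightarrow> carrier A \<and>
     (\<forall>x\<in>carrier A. \<exists>!c. (\<forall>e. c e \<in> carrier K) \<and>
        finite {e. c e \<noteq> \<zero>\<^bsub>K\<^esub>} \<and> {e. c e \<noteq> \<zero>\<^bsub>K\<^esub>} \<subseteq> E \<and>
        x = (\<Oplus>\<^bsub>A\<^esub>e\<in>{e. c e \<noteq> \<zero>\<^bsub>K\<^esub>}. c e \<odot>\<^bsub>A\<^esub> b e))"

definition ordered_monomial ::
    "('a, 'l) ring_scheme \<Rightarrow> nat \<Rightarrow> (nat \<Rightarrow> 'a) \<Rightarrow> (nat \<Rightarrow> nat) \<Rightarrow> 'a" where
  "ordered_monomial A n a e = foldr (\<lambda>i y. (a i [^]\<^bsub>A\<^esub> e i) \<otimes>\<^bsub>A\<^esub> y) [1..<Suc n] \<one>\<^bsub>A\<^esub>"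

definition PBW_basis ::
    "('k, 'm) ring_scheme \<Rightarrow> ('k, 'a, 'l) module_scheme \<Rightarrow> nat \<Rightarrow> (nat \<Rightarrow> 'a) \<Rightarrow> bool" where
  "PBW_basis K A n a \<longleftrightarrow> a \<in> {1..n} \<rightarrow> carrier A \<and>
     basis_family K A ({1..n} \<rightarrow>\<^sub>E (UNIV :: nat set)) (ordered_monomial A n a)"

definition Lambda_ring ::
    "('k, 'm) ring_scheme \<Rightarrow> ('k \<Rightarrow> 'g::linordered_ab_group_add with_infty) \<Rightarrow>
     ('k, 'a, 'l) module_scheme \<Rightarrow> nat \<Rightarrow> (nat \<Rightarrow> 'a) \<Rightarrow> ('k, 'a, 'l) module_scheme" where
  "Lambda_ring K v A n a =
     A\<lparr>carrier := free_eval K A a ` carrier (free_algebra (valuation_ring K v) {1..n})\<rparr>"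

text \<open>The product of \<open>m\<^sub>v\<close> and \<open>\<Lambda>\<close>: all finite sums of products of an element of \<open>m\<^sub>v\<close> and an
  element of \<open>\<Lambda>\<close>.\<close>

definition max_ideal_Lambda ::
    "('k, 'm) ring_scheme \<Rightarrow> ('k \<Rightarrow> 'g::linordered_ab_group_add with_infty) \<Rightarrow>
     ('k, 'a, 'l) module_scheme \<Rightarrow> nat \<Rightarrow> (nat \<Rightarrow> 'a) \<Rightarrow> 'a set" where
  "max_ideal_Lambda K v A n a =
     generate (add_monoid A)
       {c \<odot>\<^bsub>A\<^esub> x | c x. c \<in> max_ideal K v \<and> x \<in> carrier (Lambda_ring K v A n a)}"

definition Lambda_bar ::
    "('k, 'm) ring_scheme \<Rightarrow> ('k \<Rightarrow> 'g::linordered_ab_group_add with_infty) \<Rightarrow>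
     ('k, 'a, 'l) module_scheme \<Rightarrow> nat \<Rightarrow> (nat \<Rightarrow> 'a) \<Rightarrow> 'a set ring" where
  "Lambda_bar K v A n a = Lambda_ring K v A n a Quot max_ideal_Lambda K v A n a"

definition relation_ideal ::
    "('k, 'm) ring_scheme \<Rightarrow> ('k, 'a, 'l) module_scheme \<Rightarrow> nat \<Rightarrow> (nat \<Rightarrow> 'a) \<Rightarrow> (nat list \<Rightarrow> 'k) set" where
  "relation_ideal K A n a = a_kernel (free_algebra K {1..n}) A (free_eval K A a)"

definition coeff_residue ::
    "('k, 'm) ring_scheme \<Rightarrow> ('k \<Rightarrow> 'g::linordered_ab_group_add with_infty) \<Rightarrow>
     ('x list \<Rightarrow> 'k) \<Rightarrow> ('x list \<Rightarrow> 'k set)" where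
  "coeff_residue K v f = (\<lambda>w. max_ideal K v +>\<^bsub>valuation_ring K v\<^esub> f w)"

text \<open>\<open>p 1, \<dots>, p d\<close> are generators of the ideal of relations, normalized so as to have integral
  coefficients that do not all reduce to zero.\<close>

definition normalized_relations ::
    "('k, 'm) ring_scheme \<Rightarrow> ('k \<Rightarrow> 'g::linordered_ab_group_add with_infty) \<Rightarrow>
     ('k, 'a, 'l) module_scheme \<Rightarrow> nat \<Rightarrow> (nat \<Rightarrow> 'a) \<Rightarrow> nat \<Rightarrow> (nat \<Rightarrow> nat list \<Rightarrow> 'k) \<Rightarrow> bool" where
  "normalized_relations K v A n a d p \<longleftrightarrow>
     p ` {1..d} \<subseteq> carrier (free_algebra (valuation_ring K v) {1..n}) \<and>
     relation_ideal K A n a = Idl\<^bsub>free_algebra K {1..n}\<^esub> (p ` {1..d}) \<and>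
     \<not> p ` {1..d} \<subseteq> {f. \<forall>w. f w \<in> max_ideal K v}"

definition reduced_relations ::
    "('k, 'm) ring_scheme \<Rightarrow> ('k \<Rightarrow> 'g::linordered_ab_group_add with_infty) \<Rightarrow>
     nat \<Rightarrow> nat \<Rightarrow> (nat \<Rightarrow> nat list \<Rightarrow> 'k) \<Rightarrow> (nat list \<Rightarrow> 'k set) set" where
  "reduced_relations K v n d p =
     Idl\<^bsub>free_algebra (residue_field K v) {1..n}\<^esub> ((\<lambda>i. coeff_residue K v (p i)) ` {1..d})"

definition good_reduction ::
    "('k, 'm) ring_scheme \<Rightarrow> ('k \<Rightarrow> 'g::linordered_ab_group_add with_infty) \<Rightarrow>
     ('k, 'a, 'l) module_scheme \<Rightarrow> nat \<Rightarrow> (nat \<Rightarrow> 'a) \<Rightarrow> nat \<Rightarrow> (nat \<Rightarrow> nat list \<Rightarrow> 'k) \<Rightarrow> bool" where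
  "good_reduction K v A n a d p \<longleftrightarrow>
     coeff_residue K v `
       (relation_ideal K A n a \<inter> carrier (free_algebra (valuation_ring K v) {1..n})) =
     reduced_relations K v n d p"

text \<open>The algebra \<open>A(k\<^sub>v)\<close> defined over the residue field by the same relations as \<open>A\<close>.\<close>

definition residue_algebra ::
    "('k, 'm) ring_scheme \<Rightarrow> ('k \<Rightarrow> 'g::linordered_ab_group_add with_infty) \<Rightarrow>
     nat \<Rightarrow> nat \<Rightarrow> (nat \<Rightarrow> nat list \<Rightarrow> 'k) \<Rightarrow> (nat list \<Rightarrow> 'k set) set ring" where
  "residue_algebra K v n d p =
     free_algebra (residue_field K v) {1..n} Quot reduced_relations K v n d p"

text \<open>\<open>K\<close> embeds into \<open>Q\<close> by \<open>c \<mapsto> \<iota> (c \<cdot> 1)\<close>.\<close>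

definition valuation_extends ::
    "('k, 'm) ring_scheme \<Rightarrow> ('k \<Rightarrow> 'g::linordered_ab_group_add with_infty) \<Rightarrow>
     ('k, 'a, 'l) module_scheme \<Rightarrow> ('q, 'n) ring_scheme \<Rightarrow> ('a \<Rightarrow> 'q) \<Rightarrow> bool" where
  "valuation_extends K v A Q \<iota> \<longleftrightarrow>
     (\<exists>w :: 'q \<Rightarrow> 'g with_infty. ring_valuation Q w \<and>
        (\<forall>c\<in>carrier K. w (\<iota> (c \<odot>\<^bsub>A\<^esub> \<one>\<^bsub>A\<^esub>)) = v c))"

end

theory Submission
  imports Defs
begin

text \<open>The extension of \<open>v\<close> is a Gauss valuation. If \<open>x = c y\<close> with \<open>c\<close> in \<open>K\<close> nonzero and \<open>y\<close> in \<open>\<Lambda>\<close> but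
  not in \<open>m\<^sub>v \<Lambda>\<close>, then \<open>y\<close> is called primitive and \<open>x\<close> gets the value \<open>v c\<close>. This is the largest
  value of a scalar that can be taken out of \<open>x\<close>, so it is independent of the choice of \<open>c\<close> and
  the ultrametric inequality is immediate. If \<open>\<Lambda> / m\<^sub>v \<Lambda>\<close> is a domain, then products of primitive
  elements are primitive and the value is multiplicative. A valuation on an Ore domain
  extends to fractions by taking the difference of the values of numerator and denominator
  (\<open>ex_fraction_valuation\<close>).

  The point at issue is that every nonzero \<open>x\<close> is a scalar multiple of a primitive element
  (\<open>ex_primitive_multiple\<close>). In a general torsion-free module over \<open>O\<^sub>v\<close> the values of the scalars
  that can be taken out of an element need not have a maximum. The grading excludes this. The
  generators have positive degree, so only finitely many words have degree at most \<open>N\<close>, and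
  truncating at degree \<open>N\<close> commutes with evaluation in \<open>A\<close>. Everything about \<open>x\<close> therefore
  happens in the \<open>O\<^sub>v\<close>-module spanned by finitely many words. Such a module is free, although
  the ordered monomials need not be a basis of it: a relation between the words can be divided
  by its coefficient of least value, which eliminates one word. The lemma \<open>primitive_multiple\<close>
  runs this elimination only until the given element becomes primitive.

  For part (ii) it suffices that \<open>\<Lambda> / m\<^sub>v \<Lambda>\<close> is a domain. A polynomial \<open>f\<close> with coefficients in \<open>O\<^sub>v\<close>
  evaluates into \<open>m\<^sub>v \<Lambda>\<close> exactly if it differs from an integral relation by a polynomial with
  coefficients in \<open>m\<^sub>v\<close>, that is, if its residue lies in the image of the integral relations
  (\<open>ev_mem_m\<Lambda>_iff\<close>). Good reduction says that this image is the ideal defining \<open>A(k\<^sub>v)\<close>, so the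
  primeness of that ideal carries over to \<open>m\<^sub>v \<Lambda>\<close>.\<close>

section \<open>Values with infinity\<close>

instance with_infty :: (linordered_ab_group_add) ordered_comm_monoid_add
proof
  fix x y z :: "'a with_infty"
  show "x + y + z = x + (y + z)"
    by (cases x; cases y; cases z) (auto simp: add.assoc)
  show "x + y = y + x"
    by (cases x; cases y) (auto simp: add.commute)
  show "0 + x = x"
    by (cases x) (auto simp: zero_with_infty_def)
  show "x \<le> y \<Longrightarrow> z + x \<le> z + y"
    by (cases x; cases y; cases z) auto
qed

lemma Fin_add_le_iff [simp]: "Fin g + x \<le> Fin g + y \<longleftrightarrow> x \<le> y"
  by (cases x; cases y) auto

lemma Fin_add_eq_iff [simp]: "Fin g + x = Fin g + y \<longleftrightarrow> x = y"
  by (metis Fin_add_le_iff order.antisym order.refl)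

lemma Fin_less_iff [simp]: "Fin g < Fin h \<longleftrightarrow> g < h"
  by (auto simp: less_with_infty_def)

lemma le_Infty [simp]: "x \<le> (Infty :: 'g::linordered_ab_group_add with_infty)"
  by (cases x) auto

lemma add_eq_Infty_iff: "x + y = Infty \<longleftrightarrow> x = Infty \<or> y = Infty"
  by (cases x; cases y) auto

lemma add_nonneg_pos_infty:
  fixes x y :: "'g::linordered_ab_group_add with_infty"
  shows "0 \<le> x \<Longrightarrow> 0 < y \<Longrightarrow> 0 < x + y"
  by (cases x; cases y) (auto simp: zero_with_infty_def add_nonneg_pos less_with_infty_def[of _ Infty])

section \<open>Extending a valuation to fractions\<close>

locale valued_fractions = A: ring A + Q: ring Q
  for A :: "('a, 'm) ring_scheme" and Q :: "('q, 'n) ring_scheme" +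
  fixes \<iota> :: "'a \<Rightarrow> 'q" and f :: "'a \<Rightarrow> 'g::linordered_ab_group_add with_infty"
  assumes ore: "ore_domain A"
    and fractions: "classical_ring_of_fractions A Q \<iota>"
    and valuation: "ring_valuation A f"
begin

lemma iota_hom: "\<iota> \<in> ring_hom A Q"
  using fractions unfolding classical_ring_of_fractions_def by blast

lemmas iota_simps [simp] = ring_hom_closed [OF iota_hom]

lemmas iota_mult = ring_hom_mult [OF iota_hom]

lemma iota_eq_iff: "x \<in> carrier A \<Longrightarrow> y \<in> carrier A \<Longrightarrow> \<iota> x = \<iota> y \<longleftrightarrow> x = y"
  using fractions unfolding classical_ring_of_fractions_def by (blast dest: inj_onD)

lemma integral: "x \<in> carrier A \<Longrightarrow> y \<in> carrier A \<Longrightarrow> x \<otimes>\<^bsub>A\<^esub> y = \<zero>\<^bsub>A\<^esub> \<Longrightarrow> x = \<zero>\<^bsub>A\<^esub> \<or> y = \<zero>\<^bsub>A\<^esub>"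
  using ore unfolding ore_domain_def nc_domain_def by blast

lemma regular_iff: "s \<in> regular_elements A \<longleftrightarrow> s \<in> carrier A \<and> s \<noteq> \<zero>\<^bsub>A\<^esub>"
proof
  assume s: "s \<in> regular_elements A"
  have "\<one>\<^bsub>A\<^esub> \<noteq> \<zero>\<^bsub>A\<^esub>"
    using ore unfolding ore_domain_def nc_domain_def by blast
  then show "s \<in> carrier A \<and> s \<noteq> \<zero>\<^bsub>A\<^esub>"
    using s unfolding regular_elements_def by (force dest: bspec[of _ _ "\<one>\<^bsub>A\<^esub>"])
next
  assume "s \<in> carrier A \<and> s \<noteq> \<zero>\<^bsub>A\<^esub>"
  then show "s \<in> regular_elements A"
    using integral unfolding regular_elements_def by blast
qed

lemma iota_Units: "s \<in> carrier A \<Longrightarrow> s \<noteq> \<zero>\<^bsub>A\<^esub> \<Longrightarrow> \<iota> s \<in> Units Q"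
  using fractions unfolding classical_ring_of_fractions_def by (auto simp: regular_iff)

lemma right_fraction:
  assumes "q \<in> carrier Q"
  obtains x s where "x \<in> carrier A" "s \<in> carrier A" "s \<noteq> \<zero>\<^bsub>A\<^esub>" "q \<otimes>\<^bsub>Q\<^esub> \<iota> s = \<iota> x"
proof -
  obtain x s where "x \<in> carrier A" "s \<in> regular_elements A" "q = \<iota> x \<otimes>\<^bsub>Q\<^esub> inv\<^bsub>Q\<^esub> (\<iota> s)"
    using fractions assms unfolding classical_ring_of_fractions_def by blast
  then show thesis
    using that[of x s] iota_Units by (auto simp: regular_iff Q.m_assoc)
qed

lemma left_fraction:
  assumes "q \<in> carrier Q"
  obtains y t where "y \<in> carrier A" "t \<in> carrier A" "t \<noteq> \<zero>\<^bsub>A\<^esub>" "\<iota> t \<otimes>\<^bsub>Q\<^esub> q = \<iota> y"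
proof -
  obtain x s where "x \<in> carrier A" "s \<in> regular_elements A" "q = inv\<^bsub>Q\<^esub> (\<iota> s) \<otimes>\<^bsub>Q\<^esub> \<iota> x"
    using fractions assms unfolding classical_ring_of_fractions_def by blast
  then show thesis
    using that[of x s] iota_Units by (auto simp: regular_iff Q.m_assoc[symmetric])
qed

lemma f_mult: "x \<in> carrier A \<Longrightarrow> y \<in> carrier A \<Longrightarrow> f (x \<otimes>\<^bsub>A\<^esub> y) = f x + f y"
  and f_add: "x \<in> carrier A \<Longrightarrow> y \<in> carrier A \<Longrightarrow> min (f x) (f y) \<le> f (x \<oplus>\<^bsub>A\<^esub> y)"
  and f_eq_Infty_iff: "x \<in> carrier A \<Longrightarrow> f x = Infty \<longleftrightarrow> x = \<zero>\<^bsub>A\<^esub>"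
  using valuation by (auto simp: ring_valuation_def)

lemma f_finite:
  assumes "s \<in> carrier A" "s \<noteq> \<zero>\<^bsub>A\<^esub>"
  obtains h where "f s = Fin h"
  using assms f_eq_Infty_iff by (cases "f s") auto

text \<open>A left denominator and a right denominator of the same element of \<open>Q\<close> multiply out to one
  equation in \<open>A\<close>. Every right fraction can be compared with one fixed left fraction, so the
  value does not depend on the right fraction.\<close>

lemma balance:
  assumes "q \<in> carrier Q"
    and "x \<in> carrier A" "s \<in> carrier A" "q \<otimes>\<^bsub>Q\<^esub> \<iota> s = \<iota> x"
    and "y \<in> carrier A" "t \<in> carrier A" "\<iota> t \<otimes>\<^bsub>Q\<^esub> q = \<iota> y"
  shows "f t + f x = f y + f s"
proof -
  have "\<iota> (t \<otimes>\<^bsub>A\<^esub> x) = \<iota> (y \<otimes>\<^bsub>A\<^esub> s)"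
    using assms(1-3,5,6) by (simp add: iota_mult Q.m_assoc flip: assms(4,7))
  then have "t \<otimes>\<^bsub>A\<^esub> x = y \<otimes>\<^bsub>A\<^esub> s"
    using assms by (simp add: iota_eq_iff)
  then show ?thesis
    using assms by (metis f_mult)
qed

lemma ex1_value:
  assumes q: "q \<in> carrier Q"
  shows "\<exists>!g. \<forall>x\<in>carrier A. \<forall>s\<in>carrier A. q \<otimes>\<^bsub>Q\<^esub> \<iota> s = \<iota> x \<longrightarrow> f x = g + f s"
proof -
  obtain y t where yt: "y \<in> carrier A" "t \<in> carrier A" "t \<noteq> \<zero>\<^bsub>A\<^esub>" "\<iota> t \<otimes>\<^bsub>Q\<^esub> q = \<iota> y"
    using left_fraction[OF q] .
  obtain h where h: "f t = Fin h"
    using f_finite yt by blast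
  have "f x = (Fin (- h) + f y) + f s" if "x \<in> carrier A" "s \<in> carrier A" "q \<otimes>\<^bsub>Q\<^esub> \<iota> s = \<iota> x" for x s
  proof -
    have "Fin h + f x = f y + f s"
      using balance[OF q that yt(1,2,4)] h by simp
    moreover have "Fin h + (Fin (- h) + f y + f s) = f y + f s"
      by (simp only: add.assoc[symmetric] plus_with_infty.simps) (simp flip: zero_with_infty_def)
    ultimately show ?thesis
      by (metis Fin_add_eq_iff)
  qed
  moreover have "g = g'"
    if g: "\<forall>x\<in>carrier A. \<forall>s\<in>carrier A. q \<otimes>\<^bsub>Q\<^esub> \<iota> s = \<iota> x \<longrightarrow> f x = g + f s"
      and g': "\<forall>x\<in>carrier A. \<forall>s\<in>carrier A. q \<otimes>\<^bsub>Q\<^esub> \<iota> s = \<iota> x \<longrightarrow> f x = g' + f s" for g g'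
  proof -
    obtain x s where xs: "x \<in> carrier A" "s \<in> carrier A" "s \<noteq> \<zero>\<^bsub>A\<^esub>" "q \<otimes>\<^bsub>Q\<^esub> \<iota> s = \<iota> x"
      using right_fraction[OF q] .
    obtain k where k: "f s = Fin k"
      using f_finite xs by blast
    have "g + f s = g' + f s"
      using g g' xs by metis
    then have "Fin k + g = Fin k + g'"
      by (simp only: k add.commute)
    then show "g = g'"
      by simp
  qed
  ultimately show ?thesis
    by blast
qed

text \<open>The value of a right fraction \<open>x s\<^sup>-\<^sup>1\<close>, characterized by \<open>f x = g + f s\<close> because the
  values with infinity have no subtraction.\<close>

definition fraction_value :: "'q \<Rightarrow> 'g with_infty" where
  "fraction_value q = (THE g. \<forall>x\<in>carrier A. \<forall>s\<in>carrier A. q \<otimes>\<^bsub>Q\<^esub> \<iota> s = \<iota> x \<longrightarrow> f x = g + f s)"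

lemma fraction_value_right:
  assumes "q \<in> carrier Q" "x \<in> carrier A" "s \<in> carrier A" "q \<otimes>\<^bsub>Q\<^esub> \<iota> s = \<iota> x"
  shows "f x = fraction_value q + f s"
  using theI'[OF ex1_value[OF assms(1)]] assms unfolding fraction_value_def by blast

lemma fraction_value_left:
  assumes "q \<in> carrier Q" "y \<in> carrier A" "t \<in> carrier A" "\<iota> t \<otimes>\<^bsub>Q\<^esub> q = \<iota> y"
  shows "f y = f t + fraction_value q"
proof -
  obtain x s where xs: "x \<in> carrier A" "s \<in> carrier A" "s \<noteq> \<zero>\<^bsub>A\<^esub>" "q \<otimes>\<^bsub>Q\<^esub> \<iota> s = \<iota> x"
    using right_fraction[OF assms(1)] .
  obtain k where k: "f s = Fin k"
    using f_finite xs by blast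
  have "f s + f y = f s + (f t + fraction_value q)"
    using balance[OF assms(1) xs(1,2,4) assms(2-4)] fraction_value_right[OF assms(1) xs(1,2,4)]
    by (simp add: ac_simps)
  then show ?thesis
    by (simp add: k)
qed

lemma fraction_value_iota: "x \<in> carrier A \<Longrightarrow> fraction_value (\<iota> x) = f x"
proof -
  assume x: "x \<in> carrier A"
  have one: "\<one>\<^bsub>A\<^esub> \<noteq> \<zero>\<^bsub>A\<^esub>"
    using ore by (simp add: ore_domain_def nc_domain_def)
  obtain h where h: "f \<one>\<^bsub>A\<^esub> = Fin h"
    using f_finite[OF _ one] by blast
  have "f \<one>\<^bsub>A\<^esub> + f x = f \<one>\<^bsub>A\<^esub> + fraction_value (\<iota> x)"
    using fraction_value_left[of "\<iota> x" x "\<one>\<^bsub>A\<^esub>"] f_mult[of "\<one>\<^bsub>A\<^esub>" x] ring_hom_one[OF iota_hom] x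
    by simp
  then show ?thesis
    by (simp add: h)
qed

text \<open>Multiplying a left fraction by an element of \<open>A\<close> on the right changes only the numerator.
  With a right fraction as second factor of a product, this lets its denominator be cleared.\<close>

lemma fraction_value_mult_iota:
  assumes "q \<in> carrier Q" "s \<in> carrier A"
  shows "fraction_value (q \<otimes>\<^bsub>Q\<^esub> \<iota> s) = fraction_value q + f s"
proof -
  obtain y t where yt: "y \<in> carrier A" "t \<in> carrier A" "t \<noteq> \<zero>\<^bsub>A\<^esub>" "\<iota> t \<otimes>\<^bsub>Q\<^esub> q = \<iota> y"
    using left_fraction[OF assms(1)] .
  obtain h where h: "f t = Fin h"
    using f_finite yt by blast
  have "\<iota> t \<otimes>\<^bsub>Q\<^esub> (q \<otimes>\<^bsub>Q\<^esub> \<iota> s) = \<iota> (y \<otimes>\<^bsub>A\<^esub> s)"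
    using yt assms by (simp add: iota_mult Q.m_assoc[symmetric])
  then have "f (y \<otimes>\<^bsub>A\<^esub> s) = f t + fraction_value (q \<otimes>\<^bsub>Q\<^esub> \<iota> s)"
    using fraction_value_left assms yt by simp
  moreover have "f y = f t + fraction_value q"
    using fraction_value_left assms yt by simp
  ultimately show ?thesis
    using yt assms by (simp add: f_mult h add.assoc)
qed

lemma fraction_value_mult:
  assumes "q \<in> carrier Q" "r \<in> carrier Q"
  shows "fraction_value (q \<otimes>\<^bsub>Q\<^esub> r) = fraction_value q + fraction_value r"
proof -
  obtain x s where xs: "x \<in> carrier A" "s \<in> carrier A" "s \<noteq> \<zero>\<^bsub>A\<^esub>" "r \<otimes>\<^bsub>Q\<^esub> \<iota> s = \<iota> x"
    using right_fraction[OF assms(2)] .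
  obtain k where k: "f s = Fin k"
    using f_finite xs by blast
  have "fraction_value (q \<otimes>\<^bsub>Q\<^esub> r) + f s = fraction_value (q \<otimes>\<^bsub>Q\<^esub> (r \<otimes>\<^bsub>Q\<^esub> \<iota> s))"
    using fraction_value_mult_iota[of "q \<otimes>\<^bsub>Q\<^esub> r" s] assms xs(1-3) by (simp add: Q.m_assoc)
  also have "\<dots> = fraction_value q + (fraction_value r + f s)"
    using assms xs by (metis fraction_value_mult_iota fraction_value_right)
  finally have "f s + fraction_value (q \<otimes>\<^bsub>Q\<^esub> r) = f s + (fraction_value q + fraction_value r)"
    by (simp add: ac_simps)
  then show ?thesis
    by (simp add: k)
qed

lemma fraction_value_add:
  assumes "q \<in> carrier Q" "r \<in> carrier Q"
  shows "min (fraction_value q) (fraction_value r) \<le> fraction_value (q \<oplus>\<^bsub>Q\<^esub> r)"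
proof -
  obtain x s where xs: "x \<in> carrier A" "s \<in> carrier A" "s \<noteq> \<zero>\<^bsub>A\<^esub>" "q \<otimes>\<^bsub>Q\<^esub> \<iota> s = \<iota> x"
    using right_fraction[OF assms(1)] .
  obtain y t where yt: "y \<in> carrier A" "t \<in> carrier A" "t \<noteq> \<zero>\<^bsub>A\<^esub>" "r \<otimes>\<^bsub>Q\<^esub> \<iota> t = \<iota> y"
    using right_fraction[OF assms(2)] .
  \<comment> \<open>The Ore condition supplies a common right denominator.\<close>
  obtain c d where cd: "c \<in> carrier A" "d \<in> carrier A" "s \<otimes>\<^bsub>A\<^esub> c = t \<otimes>\<^bsub>A\<^esub> d" "s \<otimes>\<^bsub>A\<^esub> c \<noteq> \<zero>\<^bsub>A\<^esub>"
    using ore xs yt unfolding ore_domain_def by blast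
  define u where "u = s \<otimes>\<^bsub>A\<^esub> c"
  have u: "u \<in> carrier A" "u \<noteq> \<zero>\<^bsub>A\<^esub>"
    using cd(1,4) xs by (simp_all add: u_def)
  then obtain k where k: "f u = Fin k"
    using f_finite by blast
  have q: "q \<otimes>\<^bsub>Q\<^esub> \<iota> u = \<iota> (x \<otimes>\<^bsub>A\<^esub> c)"
    using cd(1) xs assms by (simp add: u_def iota_mult Q.m_assoc[symmetric])
  have r: "r \<otimes>\<^bsub>Q\<^esub> \<iota> u = \<iota> (y \<otimes>\<^bsub>A\<^esub> d)"
    using cd(2) yt assms by (simp add: u_def cd(3) iota_mult Q.m_assoc[symmetric])
  have "(q \<oplus>\<^bsub>Q\<^esub> r) \<otimes>\<^bsub>Q\<^esub> \<iota> u = \<iota> (x \<otimes>\<^bsub>A\<^esub> c \<oplus>\<^bsub>A\<^esub> y \<otimes>\<^bsub>A\<^esub> d)"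
    using q r u cd xs yt assms by (simp add: Q.l_distr ring_hom_add[OF iota_hom])
  then have "f (x \<otimes>\<^bsub>A\<^esub> c \<oplus>\<^bsub>A\<^esub> y \<otimes>\<^bsub>A\<^esub> d) = Fin k + fraction_value (q \<oplus>\<^bsub>Q\<^esub> r)"
    using fraction_value_right[of "q \<oplus>\<^bsub>Q\<^esub> r" _ u] u k cd(1,2) xs yt assms by (simp add: add.commute)
  moreover have "f (x \<otimes>\<^bsub>A\<^esub> c) = Fin k + fraction_value q"
    using fraction_value_right[OF _ _ _ q] u k cd xs assms by (simp add: add.commute)
  moreover have "f (y \<otimes>\<^bsub>A\<^esub> d) = Fin k + fraction_value r"
    using fraction_value_right[OF _ _ _ r] u k cd yt assms by (simp add: add.commute)
  ultimately show ?thesis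
    using f_add[of "x \<otimes>\<^bsub>A\<^esub> c" "y \<otimes>\<^bsub>A\<^esub> d"] cd xs yt by (simp add: min_le_iff_disj)
qed

lemma fraction_value_eq_Infty_iff:
  assumes "q \<in> carrier Q"
  shows "fraction_value q = Infty \<longleftrightarrow> q = \<zero>\<^bsub>Q\<^esub>"
proof -
  obtain x s where xs: "x \<in> carrier A" "s \<in> carrier A" "s \<noteq> \<zero>\<^bsub>A\<^esub>" "q \<otimes>\<^bsub>Q\<^esub> \<iota> s = \<iota> x"
    using right_fraction[OF assms] .
  have iota_zero: "\<iota> \<zero>\<^bsub>A\<^esub> = \<zero>\<^bsub>Q\<^esub>"
    using ring_hom_zero[OF iota_hom A.ring_axioms Q.ring_axioms] .
  have "fraction_value q = Infty \<longleftrightarrow> f x = Infty"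
    using fraction_value_right[OF assms xs(1,2,4)] f_eq_Infty_iff[OF xs(2)] xs(3)
    by (auto simp: add_eq_Infty_iff)
  also have "\<dots> \<longleftrightarrow> \<iota> x = \<zero>\<^bsub>Q\<^esub>"
    using xs iota_zero f_eq_Infty_iff iota_eq_iff by (metis A.zero_closed)
  also have "\<dots> \<longleftrightarrow> q = \<zero>\<^bsub>Q\<^esub>"
  proof
    assume "\<iota> x = \<zero>\<^bsub>Q\<^esub>"
    moreover have "q = q \<otimes>\<^bsub>Q\<^esub> \<iota> s \<otimes>\<^bsub>Q\<^esub> inv\<^bsub>Q\<^esub> (\<iota> s)"
      using iota_Units[OF xs(2,3)] assms xs(1-3) by (simp add: Q.m_assoc)
    ultimately show "q = \<zero>\<^bsub>Q\<^esub>"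
      using iota_Units[OF xs(2,3)] xs(4) by simp
  next
    assume "q = \<zero>\<^bsub>Q\<^esub>"
    then show "\<iota> x = \<zero>\<^bsub>Q\<^esub>"
      using xs by (metis Q.l_null iota_simps)
  qed
  finally show ?thesis .
qed

theorem ex_fraction_valuation: "\<exists>w. ring_valuation Q w \<and> (\<forall>x\<in>carrier A. w (\<iota> x) = f x)"
  using fraction_value_eq_Infty_iff fraction_value_mult fraction_value_add fraction_value_iota
  by (intro exI[of _ fraction_value]) (simp add: ring_valuation_def)

end

section \<open>Subrings and quotient rings\<close>

lemma (in ring) ring_restrict:
  assumes "H \<subseteq> carrier R" "\<one> \<in> H" "\<And>x. x \<in> H \<Longrightarrow> \<ominus> x \<in> H"
    "\<And>x y. x \<in> H \<Longrightarrow> y \<in> H \<Longrightarrow> x \<otimes> y \<in> H" "\<And>x y. x \<in> H \<Longrightarrow> y \<in> H \<Longrightarrow> x \<oplus> y \<in> H"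
  shows "ring (R\<lparr>carrier := H\<rparr>)"
proof -
  have H: "x \<in> carrier R" if "x \<in> H" for x
    using assms(1) that by blast
  have zero: "\<zero> \<in> H"
    using assms(5)[OF assms(2) assms(3)[OF assms(2)]] by (simp add: r_neg)
  show ?thesis
  proof (rule ringI)
    show "abelian_group (R\<lparr>carrier := H\<rparr>)"
    proof (rule abelian_groupI)
      fix x assume "x \<in> carrier (R\<lparr>carrier := H\<rparr>)"
      then show "\<exists>y\<in>carrier (R\<lparr>carrier := H\<rparr>). y \<oplus>\<^bsub>R\<lparr>carrier := H\<rparr>\<^esub> x = \<zero>\<^bsub>R\<lparr>carrier := H\<rparr>\<^esub>"
        using assms(3) H by (auto intro!: bexI[of _ "\<ominus> x"] simp: l_neg)
    qed (simp_all add: assms(5) zero H a_ac)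
    show "monoid (R\<lparr>carrier := H\<rparr>)"
      by (rule monoidI) (simp_all add: assms(2,4) H m_assoc)
  qed (simp_all add: H l_distr r_distr)
qed

text \<open>The analogue for noncommutative rings of the fact that prime ideals are those with a domain
  as quotient. The ideals for which the right-hand side holds are the completely prime ones.\<close>

lemma nc_domain_Quot_iff:
  assumes "ideal I R"
  shows "nc_domain (R Quot I) \<longleftrightarrow> \<one>\<^bsub>R\<^esub> \<notin> I \<and>
    (\<forall>x\<in>carrier R. \<forall>y\<in>carrier R. x \<otimes>\<^bsub>R\<^esub> y \<in> I \<longrightarrow> x \<in> I \<or> y \<in> I)"
proof -
  interpret ideal I R by fact
  have coset: "I +>\<^bsub>R\<^esub> x = I \<longleftrightarrow> x \<in> I" if "x \<in> carrier R" for x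
    using that a_rcos_const rcos_const_imp_mem by blast
  have carr: "carrier (R Quot I) = (\<lambda>x. I +>\<^bsub>R\<^esub> x) ` carrier R"
    by (auto simp: FactRing_simps)
  show ?thesis
    unfolding nc_domain_def carr using quotient_is_ring
    by (auto simp: coset FactRing_def rcoset_mult_add)
qed

section \<open>The free algebra as a ring\<close>

lemma free_algebra_carrier_iff:
  "f \<in> carrier (free_algebra R I) \<longleftrightarrow>
     (\<forall>w. f w \<in> carrier R) \<and> finite {w. f w \<noteq> \<zero>\<^bsub>R\<^esub>} \<and> {w. f w \<noteq> \<zero>\<^bsub>R\<^esub>} \<subseteq> lists I"
  by (simp add: free_algebra_def)

lemma free_algebra_carrierI:
  assumes "\<And>w. f w \<in> carrier R" "{w. f w \<noteq> \<zero>\<^bsub>R\<^esub>} \<subseteq> S" "finite S" "S \<subseteq> lists I"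
  shows "f \<in> carrier (free_algebra R I)"
  unfolding free_algebra_carrier_iff using assms by (meson finite_subset subset_trans)

lemma free_algebra_simps [simp]:
  "\<one>\<^bsub>free_algebra R I\<^esub> = (\<lambda>w. if w = [] then \<one>\<^bsub>R\<^esub> else \<zero>\<^bsub>R\<^esub>)"
  "\<zero>\<^bsub>free_algebra R I\<^esub> = (\<lambda>w. \<zero>\<^bsub>R\<^esub>)"
  "f \<oplus>\<^bsub>free_algebra R I\<^esub> g = (\<lambda>w. f w \<oplus>\<^bsub>R\<^esub> g w)"
  by (simp_all add: free_algebra_def)

definition monomial :: "('r, 'm) ring_scheme \<Rightarrow> 'r \<Rightarrow> 'x list \<Rightarrow> 'x list \<Rightarrow> 'r" where
  "monomial R c u = (\<lambda>w. if w = u then c else \<zero>\<^bsub>R\<^esub>)"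

context ring
begin

lemma free_algebra_mult_Nil:
  assumes "\<And>w. f w \<in> carrier R" "\<And>w. g w \<in> carrier R"
  shows "(f \<otimes>\<^bsub>free_algebra R I\<^esub> g) [] = f [] \<otimes> g []"
  using assms by (simp add: free_algebra_def)

text \<open>Splitting off the factorization with empty left part. This recursion in the word reduces
  identities for the convolution to identities in \<open>R\<close>.\<close>

lemma free_algebra_mult_Cons:
  assumes "\<And>w. f w \<in> carrier R" "\<And>w. g w \<in> carrier R"
  shows "(f \<otimes>\<^bsub>free_algebra R I\<^esub> g) (x # w) =
    f [] \<otimes> g (x # w) \<oplus> ((\<lambda>u. f (x # u)) \<otimes>\<^bsub>free_algebra R I\<^esub> g) w"
proof -
  have "(f \<otimes>\<^bsub>free_algebra R I\<^esub> g) (x # w) =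
      (\<Oplus>i\<in>{..Suc (length w)}. f (take i (x # w)) \<otimes> g (drop i (x # w)))"
    by (simp add: free_algebra_def)
  also have "\<dots> = (\<Oplus>i\<in>{..length w}. f (take (Suc i) (x # w)) \<otimes> g (drop (Suc i) (x # w)))
      \<oplus> f (take 0 (x # w)) \<otimes> g (drop 0 (x # w))"
    using assms by (intro finsum_Suc2) auto
  also have "\<dots> = f [] \<otimes> g (x # w) \<oplus> ((\<lambda>u. f (x # u)) \<otimes>\<^bsub>free_algebra R I\<^esub> g) w"
    using assms by (simp add: free_algebra_def a_comm)
  finally show ?thesis .
qed

lemma free_algebra_mult_in_carrier:
  assumes "\<And>w. f w \<in> carrier R" "\<And>w. g w \<in> carrier R"
  shows "(f \<otimes>\<^bsub>free_algebra R I\<^esub> g) w \<in> carrier R"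
  using assms by (simp add: free_algebra_def)

lemma free_algebra_mult_zero_left:
  assumes "\<And>w. g w \<in> carrier R"
  shows "((\<lambda>u. \<zero>) \<otimes>\<^bsub>free_algebra R I\<^esub> g) = (\<lambda>w. \<zero>)"
  using assms by (simp add: free_algebra_def)

lemma free_algebra_mult_constant_left:
  assumes "c \<in> carrier R" "\<And>w. g w \<in> carrier R"
  shows "monomial R c [] \<otimes>\<^bsub>free_algebra R I\<^esub> g = (\<lambda>w. c \<otimes> g w)"
proof
  fix w
  show "(monomial R c [] \<otimes>\<^bsub>free_algebra R I\<^esub> g) w = c \<otimes> g w"
    using assms
    by (cases w) (simp_all add: free_algebra_mult_Nil free_algebra_mult_Cons
        free_algebra_mult_zero_left monomial_def)
qed

lemma free_algebra_mult_one_right: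
  assumes "\<And>w. f w \<in> carrier R"
  shows "(f \<otimes>\<^bsub>free_algebra R I\<^esub> \<one>\<^bsub>free_algebra R I\<^esub>) w = f w"
  using assms
  by (induction w arbitrary: f) (simp_all add: free_algebra_mult_Nil free_algebra_mult_Cons)

lemma free_algebra_mult_add_left:
  assumes "\<And>w. f w \<in> carrier R" "\<And>w. f' w \<in> carrier R" "\<And>w. g w \<in> carrier R"
  shows "((\<lambda>u. f u \<oplus> f' u) \<otimes>\<^bsub>free_algebra R I\<^esub> g) w =
    (f \<otimes>\<^bsub>free_algebra R I\<^esub> g) w \<oplus> (f' \<otimes>\<^bsub>free_algebra R I\<^esub> g) w"
  using assms
  by (induction w arbitrary: f f')
    (simp_all add: free_algebra_mult_Nil free_algebra_mult_Cons free_algebra_mult_in_carrier l_distr a_ac)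

lemma free_algebra_mult_add_right:
  assumes "\<And>w. f w \<in> carrier R" "\<And>w. g w \<in> carrier R" "\<And>w. g' w \<in> carrier R"
  shows "(f \<otimes>\<^bsub>free_algebra R I\<^esub> (\<lambda>u. g u \<oplus> g' u)) w =
    (f \<otimes>\<^bsub>free_algebra R I\<^esub> g) w \<oplus> (f \<otimes>\<^bsub>free_algebra R I\<^esub> g') w"
  using assms
  by (induction w arbitrary: f)
    (simp_all add: free_algebra_mult_Nil free_algebra_mult_Cons free_algebra_mult_in_carrier r_distr a_ac)

lemma free_algebra_mult_scale_left:
  assumes "c \<in> carrier R" "\<And>w. f w \<in> carrier R" "\<And>w. g w \<in> carrier R"
  shows "((\<lambda>u. c \<otimes> f u) \<otimes>\<^bsub>free_algebra R I\<^esub> g) w = c \<otimes> (f \<otimes>\<^bsub>free_algebra R I\<^esub> g) w"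
  using assms
  by (induction w arbitrary: f)
    (simp_all add: free_algebra_mult_Nil free_algebra_mult_Cons free_algebra_mult_in_carrier r_distr m_assoc)

lemma free_algebra_mult_assoc:
  assumes "\<And>w. f w \<in> carrier R" "\<And>w. g w \<in> carrier R" "\<And>w. h w \<in> carrier R"
  shows "((f \<otimes>\<^bsub>free_algebra R I\<^esub> g) \<otimes>\<^bsub>free_algebra R I\<^esub> h) w =
    (f \<otimes>\<^bsub>free_algebra R I\<^esub> (g \<otimes>\<^bsub>free_algebra R I\<^esub> h)) w"
  using assms
proof (induction w arbitrary: f)
  case Nil
  then show ?case
    by (simp add: free_algebra_mult_Nil free_algebra_mult_in_carrier m_assoc)
next
  case (Cons x w)
  note [simp] = Cons.prems free_algebra_mult_in_carrier
  have "((f \<otimes>\<^bsub>free_algebra R I\<^esub> g) \<otimes>\<^bsub>free_algebra R I\<^esub> h) (x # w) =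
      f [] \<otimes> g [] \<otimes> h (x # w) \<oplus>
      ((\<lambda>u. f [] \<otimes> g (x # u) \<oplus> ((\<lambda>u. f (x # u)) \<otimes>\<^bsub>free_algebra R I\<^esub> g) u)
        \<otimes>\<^bsub>free_algebra R I\<^esub> h) w"
    by (simp add: free_algebra_mult_Nil free_algebra_mult_Cons)
  also have "\<dots> = f [] \<otimes> g [] \<otimes> h (x # w) \<oplus>
      (f [] \<otimes> ((\<lambda>u. g (x # u)) \<otimes>\<^bsub>free_algebra R I\<^esub> h) w
      \<oplus> ((\<lambda>u. f (x # u)) \<otimes>\<^bsub>free_algebra R I\<^esub> (g \<otimes>\<^bsub>free_algebra R I\<^esub> h)) w)"
    by (simp add: free_algebra_mult_add_left free_algebra_mult_scale_left Cons.IH)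
  also have "\<dots> = (f \<otimes>\<^bsub>free_algebra R I\<^esub> (g \<otimes>\<^bsub>free_algebra R I\<^esub> h)) (x # w)"
    by (simp add: free_algebra_mult_Cons r_distr m_assoc a_assoc)
  finally show ?case .
qed

lemma free_algebra_mult_closed:
  assumes f: "f \<in> carrier (free_algebra R I)" and g: "g \<in> carrier (free_algebra R I)"
  shows "f \<otimes>\<^bsub>free_algebra R I\<^esub> g \<in> carrier (free_algebra R I)"
proof -
  let ?S = "{w. f w \<noteq> \<zero>}" and ?T = "{w. g w \<noteq> \<zero>}"
  have carr: "\<And>w. f w \<in> carrier R" "\<And>w. g w \<in> carrier R"
    using f g by (auto simp: free_algebra_carrier_iff)
  have sub: "{w. (f \<otimes>\<^bsub>free_algebra R I\<^esub> g) w \<noteq> \<zero>} \<subseteq> (\<lambda>(u, v). u @ v) ` (?S \<times> ?T)"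
  proof
    fix w
    assume w: "w \<in> {w. (f \<otimes>\<^bsub>free_algebra R I\<^esub> g) w \<noteq> \<zero>}"
    have "\<exists>i. f (take i w) \<otimes> g (drop i w) \<noteq> \<zero>"
    proof (rule ccontr)
      assume "\<not> ?thesis"
      then have "(\<Oplus>i\<in>{..length w}. f (take i w) \<otimes> g (drop i w)) = \<zero>"
        by (intro add.finprod_one_eqI) auto
      then show False
        using w by (simp add: free_algebra_def)
    qed
    then obtain i where "f (take i w) \<noteq> \<zero>" "g (drop i w) \<noteq> \<zero>"
      using carr by (metis l_null r_null)
    then show "w \<in> (\<lambda>(u, v). u @ v) ` (?S \<times> ?T)"
      by (intro image_eqI[of _ _ "(take i w, drop i w)"]) auto
  qed
  moreover have "finite ((\<lambda>(u, v). u @ v) ` (?S \<times> ?T))"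
    using f g by (simp add: free_algebra_carrier_iff)
  moreover have "?S \<subseteq> lists I" "?T \<subseteq> lists I"
    using f g by (simp_all add: free_algebra_carrier_iff)
  then have "(\<lambda>(u, v). u @ v) ` (?S \<times> ?T) \<subseteq> lists I"
    by (auto simp: subset_iff in_lists_conv_set)
  ultimately show ?thesis
    using carr by (intro free_algebra_carrierI) (auto simp: free_algebra_mult_in_carrier)
qed

lemma free_algebra_add_closed:
  assumes "f \<in> carrier (free_algebra R I)" "g \<in> carrier (free_algebra R I)"
  shows "(\<lambda>w. f w \<oplus> g w) \<in> carrier (free_algebra R I)"
proof -
  have "{w. f w \<oplus> g w \<noteq> \<zero>} \<subseteq> {w. f w \<noteq> \<zero>} \<union> {w. g w \<noteq> \<zero>}"
    by auto
  moreover have "finite ({w. f w \<noteq> \<zero>} \<union> {w. g w \<noteq> \<zero>})"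
    "{w. f w \<noteq> \<zero>} \<union> {w. g w \<noteq> \<zero>} \<subseteq> lists I"
    using assms by (auto simp: free_algebra_carrier_iff)
  ultimately show ?thesis
    using assms by (intro free_algebra_carrierI) (auto simp: free_algebra_carrier_iff)
qed

lemma monomial_closed:
  assumes "c \<in> carrier R" "u \<in> lists I"
  shows "monomial R c u \<in> carrier (free_algebra R I)"
  using assms by (auto simp: free_algebra_carrier_iff monomial_def split: if_splits)

theorem free_algebra_ring: "ring (free_algebra R I)"
proof (rule ringI)
  note [simp] = free_algebra_add_closed free_algebra_mult_closed
  have carr: "f w \<in> carrier R" if "f \<in> carrier (free_algebra R I)" for f w
    using that by (simp add: free_algebra_carrier_iff)
  show "abelian_group (free_algebra R I)"
  proof (rule abelian_groupI)
    fix f assume f: "f \<in> carrier (free_algebra R I)"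
    then have "(\<lambda>w. \<ominus> f w) \<in> carrier (free_algebra R I)"
      by (auto simp: free_algebra_carrier_iff elim!: rev_finite_subset)
    moreover have "(\<lambda>w. \<ominus> f w) \<oplus>\<^bsub>free_algebra R I\<^esub> f = \<zero>\<^bsub>free_algebra R I\<^esub>"
      using carr[OF f] by (simp add: l_neg)
    ultimately show "\<exists>g\<in>carrier (free_algebra R I). g \<oplus>\<^bsub>free_algebra R I\<^esub> f = \<zero>\<^bsub>free_algebra R I\<^esub>"
      by blast
  qed (simp_all add: carr a_ac, simp add: free_algebra_carrier_iff)
  show "monoid (free_algebra R I)"
  proof (rule monoidI)
    show "\<one>\<^bsub>free_algebra R I\<^esub> \<in> carrier (free_algebra R I)"
      using monomial_closed[of \<one> "[]" I] by (simp add: monomial_def)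
    show "\<one>\<^bsub>free_algebra R I\<^esub> \<otimes>\<^bsub>free_algebra R I\<^esub> f = f" if "f \<in> carrier (free_algebra R I)" for f
      using free_algebra_mult_constant_left[of \<one> f I] carr[OF that] by (simp add: monomial_def)
  qed (auto simp: carr free_algebra_mult_assoc free_algebra_mult_one_right simp del: free_algebra_simps)
qed (auto simp: free_algebra_carrier_iff free_algebra_mult_add_left free_algebra_mult_add_right)

text \<open>Finitely supported functions are sums of monomials, so additive statements need to be
  checked on monomials only.\<close>

lemma free_algebra_induct [consumes 1, case_names monomial add]:
  assumes "f \<in> carrier (free_algebra R I)"
    and monomial: "\<And>c w. c \<in> carrier R \<Longrightarrow> w \<in> lists I \<Longrightarrow> P (monomial R c w)"
    and add: "\<And>f g. f \<in> carrier (free_algebra R I) \<Longrightarrow> g \<in> carrier (free_algebra R I) \<Longrightarrow>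
      P f \<Longrightarrow> P g \<Longrightarrow> P (\<lambda>w. f w \<oplus> g w)"
  shows "P f"
proof -
  have "P f" if "finite S" "S \<subseteq> lists I" "f \<in> carrier (free_algebra R I)" "{w. f w \<noteq> \<zero>} \<subseteq> S" for S f
    using that
  proof (induction S arbitrary: f rule: finite_induct)
    case empty
    then have "f = monomial R \<zero> []"
      by (auto simp: monomial_def)
    then show ?case
      using monomial[of \<zero> "[]"] by simp
  next
    case (insert u S)
    let ?g = "f(u := \<zero>)"
    have g: "?g \<in> carrier (free_algebra R I)"
      using insert.prems by (auto simp: free_algebra_carrier_iff elim!: rev_finite_subset)
    then have "P ?g"
      using insert.prems by (intro insert.IH g) auto
    moreover have "f u \<in> carrier R" "u \<in> lists I"
      using insert.prems by (auto simp: free_algebra_carrier_iff)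
    moreover have "f = (\<lambda>w. ?g w \<oplus> monomial R (f u) u w)"
      using insert.prems by (auto simp: monomial_def free_algebra_carrier_iff)
    ultimately show ?case
      using add[OF g monomial_closed] monomial by metis
  qed
  then show ?thesis
    using assms(1) by (auto simp: free_algebra_carrier_iff)
qed

end

lemma free_algebra_map_hom:
  assumes "ring R" "ring S" and h: "h \<in> ring_hom R S"
  shows "(\<lambda>f w. h (f w)) \<in> ring_hom (free_algebra R I) (free_algebra S I)"
proof -
  interpret R: ring R by fact
  interpret S: ring S by fact
  have zero: "h \<zero>\<^bsub>R\<^esub> = \<zero>\<^bsub>S\<^esub>"
    using ring_hom_zero[OF h assms(1,2)] .
  note hs = ring_hom_closed[OF h] ring_hom_mult[OF h] ring_hom_add[OF h] ring_hom_one[OF h] zero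
  have mult: "h ((f \<otimes>\<^bsub>free_algebra R I\<^esub> g) w) = ((\<lambda>w. h (f w)) \<otimes>\<^bsub>free_algebra S I\<^esub> (\<lambda>w. h (g w))) w"
    if "\<And>w. f w \<in> carrier R" "\<And>w. g w \<in> carrier R" for f g w
    using that
  proof (induction w arbitrary: f)
    case Nil
    then show ?case
      by (simp add: R.free_algebra_mult_Nil S.free_algebra_mult_Nil hs)
  next
    case (Cons x w)
    then show ?case
      by (simp add: R.free_algebra_mult_Cons S.free_algebra_mult_Cons
          R.free_algebra_mult_in_carrier hs)
  qed
  show ?thesis
  proof (rule ring_hom_memI)
    fix f assume "f \<in> carrier (free_algebra R I)"
    then show "(\<lambda>w. h (f w)) \<in> carrier (free_algebra S I)"
      by (intro free_algebra_carrierI[of _ _ "{w. f w \<noteq> \<zero>\<^bsub>R\<^esub>}"])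
        (auto simp: free_algebra_carrier_iff hs)
  qed (auto simp: fun_eq_iff mult free_algebra_carrier_iff hs)
qed

section \<open>Valued fields\<close>

locale valued_field = field K for K :: "('k, 'm) ring_scheme" (structure) +
  fixes v :: "'k \<Rightarrow> 'g::linordered_ab_group_add with_infty"
  assumes valuation: "ring_valuation K v"
begin

lemma v_mult: "x \<in> carrier K \<Longrightarrow> y \<in> carrier K \<Longrightarrow> v (x \<otimes> y) = v x + v y"
  and v_add: "x \<in> carrier K \<Longrightarrow> y \<in> carrier K \<Longrightarrow> min (v x) (v y) \<le> v (x \<oplus> y)"
  and v_eq_Infty_iff: "x \<in> carrier K \<Longrightarrow> v x = Infty \<longleftrightarrow> x = \<zero>"
  using valuation by (auto simp: ring_valuation_def)

lemma v_zero [simp]: "v \<zero> = Infty"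
  by (simp add: v_eq_Infty_iff)

lemma v_finite:
  assumes "x \<in> carrier K" "x \<noteq> \<zero>"
  obtains g where "v x = Fin g"
  using assms v_eq_Infty_iff by (cases "v x") auto

lemma v_one [simp]: "v \<one> = 0"
proof -
  obtain g where "v \<one> = Fin g"
    using v_finite[of \<one>] by auto
  then show ?thesis
    using v_mult[of \<one> \<one>] by (simp add: zero_with_infty_def)
qed

lemma v_minus:
  assumes "x \<in> carrier K"
  shows "v (\<ominus> x) = v x"
proof -
  obtain g where g: "v (\<ominus> \<one>) = Fin g"
    using v_finite[of "\<ominus> \<one>"] by (metis a_inv_closed minus_minus minus_zero one_closed one_not_zero)
  have "v (\<ominus> \<one>) + v (\<ominus> \<one>) = v \<one>"
    using v_mult[of "\<ominus> \<one>" "\<ominus> \<one>"] by (simp add: l_minus)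
  then have "v (\<ominus> \<one>) = 0"
    by (simp add: g zero_with_infty_def)
  then show ?thesis
    using v_mult[of "\<ominus> \<one>" x] assms by (simp add: l_minus)
qed

lemma nonzero_inverse:
  assumes "x \<in> carrier K" "x \<noteq> \<zero>"
  shows "inv x \<in> carrier K" "x \<otimes> inv x = \<one>" "inv x \<otimes> x = \<one>" "inv x \<noteq> \<zero>" "v x + v (inv x) = 0"
proof -
  have "x \<in> Units K"
    using assms by (simp add: field_Units)
  then show "inv x \<in> carrier K" "x \<otimes> inv x = \<one>" "inv x \<otimes> x = \<one>"
    by simp_all
  then show "inv x \<noteq> \<zero>" "v x + v (inv x) = 0"
    using assms v_mult[of x "inv x"] by auto
qed

lemma factor_through:
  assumes "x \<in> carrier K" "x \<noteq> \<zero>" "y \<in> carrier K"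
  obtains z where "z \<in> carrier K" "y = x \<otimes> z" "v y = v x + v z"
    "v x \<le> v y \<longleftrightarrow> 0 \<le> v z" "v x < v y \<longleftrightarrow> 0 < v z"
proof -
  let ?z = "inv x \<otimes> y"
  have z: "?z \<in> carrier K" "y = x \<otimes> ?z"
    using assms nonzero_inverse by (simp_all add: m_assoc[symmetric])
  then have vz: "v y = v x + v ?z"
    using assms(1) v_mult by metis
  obtain g where g: "v x = Fin g"
    using v_finite assms by blast
  have "v x \<le> v y \<longleftrightarrow> 0 \<le> v ?z"
    using Fin_add_le_iff[of g 0 "v ?z"] by (simp add: vz g)
  moreover have "v x < v y \<longleftrightarrow> 0 < v ?z"
    using Fin_add_le_iff[of g "v ?z" 0] by (simp add: vz g not_le[symmetric])
  ultimately show thesis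
    using that z vz by blast
qed

abbreviation integers :: "'k set" where
  "integers \<equiv> carrier (valuation_ring K v)"

abbreviation nonunits :: "'k set" where
  "nonunits \<equiv> max_ideal K v"

lemma integers_iff: "x \<in> integers \<longleftrightarrow> x \<in> carrier K \<and> 0 \<le> v x"
  and nonunits_iff: "x \<in> nonunits \<longleftrightarrow> x \<in> carrier K \<and> 0 < v x"
  by (simp_all add: valuation_ring_def max_ideal_def)

lemma valuation_ring_simps [simp]:
  "\<zero>\<^bsub>valuation_ring K v\<^esub> = \<zero>" "\<one>\<^bsub>valuation_ring K v\<^esub> = \<one>"
  "x \<otimes>\<^bsub>valuation_ring K v\<^esub> y = x \<otimes> y" "x \<oplus>\<^bsub>valuation_ring K v\<^esub> y = x \<oplus> y"
  by (simp_all add: valuation_ring_def)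

lemma integers_closed:
  "\<zero> \<in> integers" "\<one> \<in> integers"
  "x \<in> integers \<Longrightarrow> \<ominus> x \<in> integers"
  "x \<in> integers \<Longrightarrow> y \<in> integers \<Longrightarrow> x \<otimes> y \<in> integers"
  "x \<in> integers \<Longrightarrow> y \<in> integers \<Longrightarrow> x \<oplus> y \<in> integers"
  using order.trans[OF _ v_add[of x y]]
  by (auto simp: integers_iff v_minus v_mult)

lemma nonunits_closed:
  "\<zero> \<in> nonunits"
  "x \<in> nonunits \<Longrightarrow> \<ominus> x \<in> nonunits"
  "x \<in> integers \<Longrightarrow> y \<in> nonunits \<Longrightarrow> x \<otimes> y \<in> nonunits"
  "x \<in> nonunits \<Longrightarrow> y \<in> nonunits \<Longrightarrow> x \<oplus> y \<in> nonunits"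
  using less_le_trans[OF _ v_add[of x y]]
  by (auto simp: nonunits_iff integers_iff v_minus v_mult add_nonneg_pos_infty)
    (simp add: zero_with_infty_def less_with_infty_def)

lemma nonunits_subset: "nonunits \<subseteq> integers"
  by (auto simp: nonunits_iff integers_iff)

lemma ring_valuation_ring: "ring (valuation_ring K v)"
  unfolding valuation_ring_def
  by (rule ring_restrict) (use integers_closed in \<open>auto simp: integers_iff\<close>)

lemma ideal_max_ideal: "ideal nonunits (valuation_ring K v)"
proof (rule idealI[OF ring_valuation_ring])
  interpret V: ring "valuation_ring K v"
    by (rule ring_valuation_ring)
  have neg: "\<ominus>\<^bsub>valuation_ring K v\<^esub> x = \<ominus> x" if "x \<in> integers" for x
  proof (rule V.minus_equality)
    show "\<ominus> x \<oplus>\<^bsub>valuation_ring K v\<^esub> x = \<zero>\<^bsub>valuation_ring K v\<^esub>"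
      using that by (simp add: l_neg integers_iff)
  qed (use that in \<open>simp_all add: integers_closed\<close>)
  show "subgroup nonunits (add_monoid (valuation_ring K v))"
    using nonunits_subset
    by (intro V.add.subgroupI) (auto simp: neg nonunits_closed intro: nonunits_closed(1))
  show "x \<otimes>\<^bsub>valuation_ring K v\<^esub> c \<in> nonunits" "c \<otimes>\<^bsub>valuation_ring K v\<^esub> x \<in> nonunits"
    if "c \<in> nonunits" "x \<in> integers" for c x
    using nonunits_closed(3)[OF that(2,1)] that by (auto simp: m_comm nonunits_iff integers_iff)
qed

end

section \<open>Finitely generated modules over a valuation ring\<close>

locale valued_module = K: valued_field K v + module K M
  for K :: "('k, 'm) ring_scheme" and v :: "'k \<Rightarrow> 'g::linordered_ab_group_add with_infty"
    and M :: "('k, 'a, 'l) module_scheme"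
begin

definition combinations :: "('w \<Rightarrow> 'a) \<Rightarrow> 'k set \<Rightarrow> 'w set \<Rightarrow> 'a set" where
  "combinations b J B = {(\<Oplus>\<^bsub>M\<^esub>w\<in>B. c w \<odot>\<^bsub>M\<^esub> b w) | c. c \<in> B \<rightarrow> J}"

text \<open>With \<open>J\<close> the field, its valuation ring or the maximal ideal, \<open>combinations b J B\<close> is the space
  spanned by the finite family \<open>b\<close>, the lattice spanned by it, or the multiple of this lattice by
  the maximal ideal.\<close>

lemma combinations_mono_remove:
  assumes "finite B" "w0 \<in> B" "b \<in> B \<rightarrow> carrier M" "\<zero>\<^bsub>K\<^esub> \<in> J" "J \<subseteq> carrier K"
  shows "combinations b J (B - {w0}) \<subseteq> combinations b J B"
proof
  fix x assume "x \<in> combinations b J (B - {w0})"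
  then obtain c where c: "c \<in> B - {w0} \<rightarrow> J" "x = (\<Oplus>\<^bsub>M\<^esub>w\<in>B - {w0}. c w \<odot>\<^bsub>M\<^esub> b w)"
    by (auto simp: combinations_def)
  have "x = (\<Oplus>\<^bsub>M\<^esub>w\<in>B. (c(w0 := \<zero>\<^bsub>K\<^esub>)) w \<odot>\<^bsub>M\<^esub> b w)"
    unfolding c(2) using assms c(1)
    by (intro M.add.finprod_mono_neutral_cong_left) (auto simp: Pi_def subset_iff)
  moreover have "c(w0 := \<zero>\<^bsub>K\<^esub>) \<in> B \<rightarrow> J"
    using c(1) assms(4) by auto
  ultimately show "x \<in> combinations b J B"
    unfolding combinations_def by blast
qed

text \<open>Substituting a combination of the other generators for the one with index \<open>w0\<close> keeps the
  coefficients in \<open>J\<close>, because \<open>J\<close> absorbs the coefficients \<open>E\<close> of that combination. In the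
  application \<open>E\<close> is the valuation ring.\<close>

lemma combinations_eliminate:
  assumes "finite B" "w0 \<in> B" "b \<in> B \<rightarrow> carrier M"
    and e: "e \<in> B - {w0} \<rightarrow> E" "E \<subseteq> carrier K" "b w0 = (\<Oplus>\<^bsub>M\<^esub>w\<in>B - {w0}. e w \<odot>\<^bsub>M\<^esub> b w)"
    and J: "J \<subseteq> carrier K" "\<And>c d. c \<in> J \<Longrightarrow> d \<in> J \<Longrightarrow> c \<oplus>\<^bsub>K\<^esub> d \<in> J"
      "\<And>c d. c \<in> J \<Longrightarrow> d \<in> E \<Longrightarrow> c \<otimes>\<^bsub>K\<^esub> d \<in> J"
  shows "combinations b J B \<subseteq> combinations b J (B - {w0})"
proof
  fix x assume "x \<in> combinations b J B"
  then obtain c where c: "c \<in> B \<rightarrow> J" and x: "x = (\<Oplus>\<^bsub>M\<^esub>w\<in>B. c w \<odot>\<^bsub>M\<^esub> b w)"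
    by (auto simp: combinations_def)
  have cK: "c w \<in> carrier K" if "w \<in> B" for w
    using c J(1) that by auto
  have eK: "e w \<in> carrier K" if "w \<in> B" "w \<noteq> w0" for w
    using e(1,2) that by auto
  have bM: "b w \<in> carrier M" if "w \<in> B" for w
    using assms(3) that by auto
  note [simp] = cK eK bM
  have "x = (\<Oplus>\<^bsub>M\<^esub>w\<in>insert w0 (B - {w0}). c w \<odot>\<^bsub>M\<^esub> b w)"
    using assms(2) by (simp add: x insert_absorb)
  also have "\<dots> = c w0 \<odot>\<^bsub>M\<^esub> b w0 \<oplus>\<^bsub>M\<^esub> (\<Oplus>\<^bsub>M\<^esub>w\<in>B - {w0}. c w \<odot>\<^bsub>M\<^esub> b w)"
    using assms(1,2) by (intro M.finsum_insert) auto
  also have "c w0 \<odot>\<^bsub>M\<^esub> b w0 = (\<Oplus>\<^bsub>M\<^esub>w\<in>B - {w0}. c w0 \<odot>\<^bsub>M\<^esub> (e w \<odot>\<^bsub>M\<^esub> b w))"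
    using assms(1,2) unfolding e(3) by (intro finsum_smult_ldistr) auto
  also have "\<dots> \<oplus>\<^bsub>M\<^esub> (\<Oplus>\<^bsub>M\<^esub>w\<in>B - {w0}. c w \<odot>\<^bsub>M\<^esub> b w) =
      (\<Oplus>\<^bsub>M\<^esub>w\<in>B - {w0}. c w0 \<odot>\<^bsub>M\<^esub> (e w \<odot>\<^bsub>M\<^esub> b w) \<oplus>\<^bsub>M\<^esub> c w \<odot>\<^bsub>M\<^esub> b w)"
    using assms(1,2) by (intro M.finsum_addf[symmetric]) auto
  also have "\<dots> = (\<Oplus>\<^bsub>M\<^esub>w\<in>B - {w0}. (c w0 \<otimes>\<^bsub>K\<^esub> e w \<oplus>\<^bsub>K\<^esub> c w) \<odot>\<^bsub>M\<^esub> b w)"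
    using assms(2) by (intro M.finsum_cong') (auto simp: smult_l_distr smult_assoc1)
  finally show "x \<in> combinations b J (B - {w0})"
    unfolding combinations_def using c e(1) J(2,3) assms(2)
    by (intro CollectI exI[of _ "\<lambda>w. c w0 \<otimes>\<^bsub>K\<^esub> e w \<oplus>\<^bsub>K\<^esub> c w"] conjI) (auto simp: Pi_iff)
qed

text \<open>Dividing by a coefficient of least value leaves an integral combination \<open>y\<close> with one
  coefficient equal to 1. If \<open>y\<close> is nevertheless a combination with coefficients in the maximal
  ideal, the difference of the two representations is a relation with a unit coefficient, which
  makes one generator redundant. So induction on the number of generators applies.\<close>

lemma primitive_multiple:
  assumes "finite B" "b \<in> B \<rightarrow> carrier M" "x \<in> combinations b (carrier K) B" "x \<noteq> \<zero>\<^bsub>M\<^esub>"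
  shows "\<exists>c\<in>carrier K - {\<zero>\<^bsub>K\<^esub>}. \<exists>y\<in>combinations b K.integers B.
    x = c \<odot>\<^bsub>M\<^esub> y \<and> y \<notin> combinations b K.nonunits B"
  using assms
proof (induction "card B" arbitrary: B rule: less_induct)
  case less
  note B = less.prems(1,2)
  then have bM: "b w \<in> carrier M" if "w \<in> B" for w
    using that by auto
  note [simp] = bM
  obtain c where c: "c \<in> B \<rightarrow> carrier K" and x: "x = (\<Oplus>\<^bsub>M\<^esub>w\<in>B. c w \<odot>\<^bsub>M\<^esub> b w)"
    using less.prems(3) by (auto simp: combinations_def)
  have cK [simp]: "c w \<in> carrier K" if "w \<in> B" for w
    using c that by auto
  obtain w1 where w1: "w1 \<in> B" "c w1 \<noteq> \<zero>\<^bsub>K\<^esub>"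
  proof (rule ccontr)
    assume "\<not> thesis"
    then have "\<forall>w\<in>B. c w = \<zero>\<^bsub>K\<^esub>"
      using that by blast
    then have "x = \<zero>\<^bsub>M\<^esub>"
      unfolding x by (intro M.add.finprod_one_eqI) auto
    then show False
      using less.prems(4) by simp
  qed
  obtain w0 where w0: "w0 \<in> B" and min: "\<And>w. w \<in> B \<Longrightarrow> v (c w0) \<le> v (c w)"
  proof -
    have "Min ((\<lambda>w. v (c w)) ` B) \<in> (\<lambda>w. v (c w)) ` B"
      using B w1 by (intro Min_in) auto
    then obtain w0 where "w0 \<in> B" "v (c w0) = Min ((\<lambda>w. v (c w)) ` B)"
      by auto
    then show thesis
      using that B by simp
  qed
  have c0: "c w0 \<noteq> \<zero>\<^bsub>K\<^esub>"
    using min[OF w1(1)] w1 w0 K.v_eq_Infty_iff[of "c w1"] by (cases "v (c w1)") auto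
  define e where "e w = inv\<^bsub>K\<^esub> (c w0) \<otimes>\<^bsub>K\<^esub> c w" for w
  have e: "e w \<in> K.integers" "c w = c w0 \<otimes>\<^bsub>K\<^esub> e w" if w: "w \<in> B" for w
  proof -
    obtain z where "z \<in> carrier K" "c w = c w0 \<otimes>\<^bsub>K\<^esub> z" "0 \<le> v z"
      using K.factor_through[OF cK[OF w0] c0 cK[OF w]] min[OF w] by metis
    moreover from this have "e w = z"
      using K.nonzero_inverse[OF cK[OF w0] c0] cK[OF w0]
      by (simp add: e_def K.m_assoc[symmetric])
    ultimately show "e w \<in> K.integers" "c w = c w0 \<otimes>\<^bsub>K\<^esub> e w"
      by (simp_all add: K.integers_iff)
  qed
  have eK [simp]: "e w \<in> carrier K" if "w \<in> B" for w
    using e that by (simp add: K.integers_iff)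
  have e0: "e w0 = \<one>\<^bsub>K\<^esub>"
    using K.nonzero_inverse[OF cK[OF w0] c0] by (simp add: e_def)
  define y where "y = (\<Oplus>\<^bsub>M\<^esub>w\<in>B. e w \<odot>\<^bsub>M\<^esub> b w)"
  have "y \<in> combinations b K.integers B"
    using e by (auto simp: y_def combinations_def)
  have "x = (\<Oplus>\<^bsub>M\<^esub>w\<in>B. c w0 \<odot>\<^bsub>M\<^esub> (e w \<odot>\<^bsub>M\<^esub> b w))"
    unfolding x using w0
    by (intro M.finsum_cong') (auto simp: smult_assoc1[symmetric] e(2)[symmetric])
  also have "\<dots> = c w0 \<odot>\<^bsub>M\<^esub> y"
    unfolding y_def using w0 B(1) by (intro finsum_smult_ldistr[symmetric]) auto
  finally have xy: "x = c w0 \<odot>\<^bsub>M\<^esub> y" .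
  show ?case
  proof (cases "y \<in> combinations b K.nonunits B")
    case False
    then show ?thesis
      using xy c0 cK[OF w0] \<open>y \<in> combinations b K.integers B\<close> by blast
  next
    case True
    then obtain d where d: "d \<in> B \<rightarrow> K.nonunits" and yd: "y = (\<Oplus>\<^bsub>M\<^esub>w\<in>B. d w \<odot>\<^bsub>M\<^esub> b w)"
      by (auto simp: combinations_def)
    have dK [simp]: "d w \<in> carrier K" if "w \<in> B" for w
      using d that by (auto simp: K.nonunits_iff)
    define u where "u w = d w \<ominus>\<^bsub>K\<^esub> e w" for w
    have uO: "u w \<in> K.integers" if "w \<in> B" for w
      using d e(1)[OF that] that K.nonunits_subset unfolding u_def a_minus_def
      by (intro K.integers_closed) auto
    then have uK [simp]: "u w \<in> carrier K" if "w \<in> B" for w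
      using that by (simp add: K.integers_iff)
    \<comment> \<open>The coefficient at \<open>w0\<close> is a unit, because \<open>d w0\<close> is a nonunit and \<open>e w0 = 1\<close>.\<close>
    have "\<not> 0 < v (u w0)"
    proof
      assume "0 < v (u w0)"
      then have "d w0 \<oplus>\<^bsub>K\<^esub> \<ominus>\<^bsub>K\<^esub> u w0 \<in> K.nonunits"
        using d w0 by (intro K.nonunits_closed) (auto simp: K.nonunits_iff)
      moreover have "d w0 \<oplus>\<^bsub>K\<^esub> \<ominus>\<^bsub>K\<^esub> u w0 = \<one>\<^bsub>K\<^esub>"
        using w0 by (simp add: u_def e0 K.minus_add a_minus_def K.a_assoc[symmetric] K.r_neg)
      ultimately show False
        by (simp add: K.nonunits_iff)
    qed
    then have v0: "v (u w0) = 0"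
      using uO[OF w0] by (auto simp: K.integers_iff)
    then have u0: "u w0 \<noteq> \<zero>\<^bsub>K\<^esub>"
      by (auto simp: zero_with_infty_def)
    define i where "i = \<ominus>\<^bsub>K\<^esub> (inv\<^bsub>K\<^esub> (u w0))"
    have i: "i \<in> K.integers" "i \<otimes>\<^bsub>K\<^esub> u w0 = \<ominus>\<^bsub>K\<^esub> \<one>\<^bsub>K\<^esub>"
      using K.nonzero_inverse[OF uK[OF w0] u0] v0 w0
      by (simp_all add: i_def K.integers_iff K.v_minus K.l_minus)
    then have iK [simp]: "i \<in> carrier K"
      by (simp add: K.integers_iff)
    have "(\<Oplus>\<^bsub>M\<^esub>w\<in>B. d w \<odot>\<^bsub>M\<^esub> b w) = (\<Oplus>\<^bsub>M\<^esub>w\<in>B. u w \<odot>\<^bsub>M\<^esub> b w \<oplus>\<^bsub>M\<^esub> e w \<odot>\<^bsub>M\<^esub> b w)"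
      by (intro M.finsum_cong')
        (auto simp: u_def smult_l_distr[symmetric] a_minus_def K.a_assoc K.l_neg)
    also have "\<dots> = (\<Oplus>\<^bsub>M\<^esub>w\<in>B. u w \<odot>\<^bsub>M\<^esub> b w) \<oplus>\<^bsub>M\<^esub> y"
      unfolding y_def using B(1) by (intro M.finsum_addf) auto
    finally have "(\<Oplus>\<^bsub>M\<^esub>w\<in>B. u w \<odot>\<^bsub>M\<^esub> b w) \<oplus>\<^bsub>M\<^esub> y = y"
      by (simp add: yd)
    moreover have "(\<Oplus>\<^bsub>M\<^esub>w\<in>B. u w \<odot>\<^bsub>M\<^esub> b w) \<in> carrier M" "y \<in> carrier M"
      unfolding y_def by (auto intro!: M.finsum_closed)
    ultimately have "(\<Oplus>\<^bsub>M\<^esub>w\<in>B. u w \<odot>\<^bsub>M\<^esub> b w) = \<zero>\<^bsub>M\<^esub>"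
      by simp
    moreover have "(\<Oplus>\<^bsub>M\<^esub>w\<in>B. u w \<odot>\<^bsub>M\<^esub> b w) = (\<Oplus>\<^bsub>M\<^esub>w\<in>insert w0 (B - {w0}). u w \<odot>\<^bsub>M\<^esub> b w)"
      using w0 by (simp add: insert_absorb)
    moreover have "\<dots> = u w0 \<odot>\<^bsub>M\<^esub> b w0 \<oplus>\<^bsub>M\<^esub> (\<Oplus>\<^bsub>M\<^esub>w\<in>B - {w0}. u w \<odot>\<^bsub>M\<^esub> b w)"
      using w0 B(1) by (intro M.finsum_insert) auto
    ultimately have "u w0 \<odot>\<^bsub>M\<^esub> b w0 \<oplus>\<^bsub>M\<^esub> (\<Oplus>\<^bsub>M\<^esub>w\<in>B - {w0}. u w \<odot>\<^bsub>M\<^esub> b w) = \<zero>\<^bsub>M\<^esub>"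
      by simp
    then have "i \<odot>\<^bsub>M\<^esub> (u w0 \<odot>\<^bsub>M\<^esub> b w0 \<oplus>\<^bsub>M\<^esub> (\<Oplus>\<^bsub>M\<^esub>w\<in>B - {w0}. u w \<odot>\<^bsub>M\<^esub> b w)) = \<zero>\<^bsub>M\<^esub>"
      using smult_r_null[OF iK] by simp
    moreover have rest: "(\<Oplus>\<^bsub>M\<^esub>w\<in>B - {w0}. u w \<odot>\<^bsub>M\<^esub> b w) \<in> carrier M"
      by (auto intro!: M.finsum_closed)
    moreover have "i \<odot>\<^bsub>M\<^esub> (u w0 \<odot>\<^bsub>M\<^esub> b w0) = \<ominus>\<^bsub>M\<^esub> b w0"
      using w0 i(2) smult_l_minus[of "\<one>\<^bsub>K\<^esub>" "b w0"] by (simp add: smult_assoc1[symmetric])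
    ultimately have "\<ominus>\<^bsub>M\<^esub> b w0 \<oplus>\<^bsub>M\<^esub> i \<odot>\<^bsub>M\<^esub> (\<Oplus>\<^bsub>M\<^esub>w\<in>B - {w0}. u w \<odot>\<^bsub>M\<^esub> b w) = \<zero>\<^bsub>M\<^esub>"
      using w0 by (simp add: smult_r_distr)
    then have "i \<odot>\<^bsub>M\<^esub> (\<Oplus>\<^bsub>M\<^esub>w\<in>B - {w0}. u w \<odot>\<^bsub>M\<^esub> b w) \<oplus>\<^bsub>M\<^esub> \<ominus>\<^bsub>M\<^esub> b w0 = \<zero>\<^bsub>M\<^esub>"
      using w0 rest by (subst M.a_comm) simp_all
    then have "\<ominus>\<^bsub>M\<^esub> (\<ominus>\<^bsub>M\<^esub> b w0) = i \<odot>\<^bsub>M\<^esub> (\<Oplus>\<^bsub>M\<^esub>w\<in>B - {w0}. u w \<odot>\<^bsub>M\<^esub> b w)"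
      using w0 rest by (intro M.minus_equality) simp_all
    then have "b w0 = i \<odot>\<^bsub>M\<^esub> (\<Oplus>\<^bsub>M\<^esub>w\<in>B - {w0}. u w \<odot>\<^bsub>M\<^esub> b w)"
      using w0 by simp
    also have "\<dots> = (\<Oplus>\<^bsub>M\<^esub>w\<in>B - {w0}. i \<odot>\<^bsub>M\<^esub> (u w \<odot>\<^bsub>M\<^esub> b w))"
      using B(1) by (intro finsum_smult_ldistr) auto
    also have "\<dots> = (\<Oplus>\<^bsub>M\<^esub>w\<in>B - {w0}. (i \<otimes>\<^bsub>K\<^esub> u w) \<odot>\<^bsub>M\<^esub> b w)"
      by (intro M.finsum_cong') (auto simp: smult_assoc1)
    finally have b0: "b w0 = (\<Oplus>\<^bsub>M\<^esub>w\<in>B - {w0}. (i \<otimes>\<^bsub>K\<^esub> u w) \<odot>\<^bsub>M\<^esub> b w)" .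
    have coeff: "(\<lambda>w. i \<otimes>\<^bsub>K\<^esub> u w) \<in> B - {w0} \<rightarrow> K.integers" "K.integers \<subseteq> carrier K"
      using i(1) uO by (auto intro: K.integers_closed simp: K.integers_iff[THEN iffD1])
    have "x \<in> combinations b (carrier K) (B - {w0})"
      using combinations_eliminate[OF B(1) w0 B(2) coeff b0, of "carrier K"] coeff(2) less.prems(3)
      by auto
    moreover have "card (B - {w0}) < card B" "b \<in> B - {w0} \<rightarrow> carrier M"
      using B w0 by (simp_all add: card_Diff1_less del: card_Diff_insert)
    ultimately obtain c' y' where cy: "c' \<in> carrier K - {\<zero>\<^bsub>K\<^esub>}" "y' \<in> combinations b K.integers (B - {w0})"
        "x = c' \<odot>\<^bsub>M\<^esub> y'" "y' \<notin> combinations b K.nonunits (B - {w0})"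
      using less.hyps[of "B - {w0}"] B(1) less.prems(4) by blast
    have "y' \<in> combinations b K.integers B"
      using combinations_mono_remove[OF B(1) w0 B(2) K.integers_closed(1) coeff(2)] cy(2) by auto
    moreover have "y' \<notin> combinations b K.nonunits B"
    proof -
      have "c \<otimes>\<^bsub>K\<^esub> d \<in> K.nonunits" if "c \<in> K.nonunits" "d \<in> K.integers" for c d
        using K.nonunits_closed(3)[OF that(2,1)] that
        by (simp add: K.nonunits_iff K.integers_iff K.m_comm)
      then show ?thesis
        using combinations_eliminate[OF B(1) w0 B(2) coeff b0, of K.nonunits] cy(4)
          K.nonunits_subset coeff(2) K.nonunits_closed(4) by blast
    qed
    ultimately show ?thesis
      using cy by blast
  qed
qed

end

section \<open>Evaluating noncommutative polynomials\<close>

definition word_value :: "('a, 'm) ring_scheme \<Rightarrow> ('x \<Rightarrow> 'a) \<Rightarrow> 'x list \<Rightarrow> 'a" where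
  "word_value A a w = foldr (\<lambda>i y. a i \<otimes>\<^bsub>A\<^esub> y) w \<one>\<^bsub>A\<^esub>"

lemma word_value_simps [simp]:
  "word_value A a [] = \<one>\<^bsub>A\<^esub>" "word_value A a (i # w) = a i \<otimes>\<^bsub>A\<^esub> word_value A a w"
  by (simp_all add: word_value_def)

locale free_evaluation = K: cring K + A: ring A + module K A
  for K :: "('k, 'm) ring_scheme" and A :: "('k, 'a, 'l) module_scheme" +
  fixes a :: "'x \<Rightarrow> 'a" and I :: "'x set"
  assumes smult_mult_left: "c \<in> carrier K \<Longrightarrow> x \<in> carrier A \<Longrightarrow> y \<in> carrier A \<Longrightarrow>
      (c \<odot>\<^bsub>A\<^esub> x) \<otimes>\<^bsub>A\<^esub> y = c \<odot>\<^bsub>A\<^esub> (x \<otimes>\<^bsub>A\<^esub> y)"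
    and smult_mult_right: "c \<in> carrier K \<Longrightarrow> x \<in> carrier A \<Longrightarrow> y \<in> carrier A \<Longrightarrow>
      x \<otimes>\<^bsub>A\<^esub> (c \<odot>\<^bsub>A\<^esub> y) = c \<odot>\<^bsub>A\<^esub> (x \<otimes>\<^bsub>A\<^esub> y)"
    and letters: "a \<in> I \<rightarrow> carrier A"
begin

abbreviation F :: "('x list \<Rightarrow> 'k) ring" where
  "F \<equiv> free_algebra K I"

abbreviation ev :: "('x list \<Rightarrow> 'k) \<Rightarrow> 'a" where
  "ev \<equiv> free_eval K A a"

abbreviation word :: "'x list \<Rightarrow> 'a" where
  "word \<equiv> word_value A a"

lemma word_closed [simp]: "w \<in> lists I \<Longrightarrow> word w \<in> carrier A"
  using letters by (induction w) auto

lemma word_append: "u \<in> lists I \<Longrightarrow> w \<in> lists I \<Longrightarrow> word (u @ w) = word u \<otimes>\<^bsub>A\<^esub> word w"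
  using letters by (induction u) (auto simp: A.m_assoc Pi_iff)

lemma ev_eq_finsum:
  assumes "\<And>w. w \<in> S \<Longrightarrow> f w \<in> carrier K" "finite S" "S \<subseteq> lists I" "{w. f w \<noteq> \<zero>\<^bsub>K\<^esub>} \<subseteq> S"
  shows "ev f = (\<Oplus>\<^bsub>A\<^esub>w\<in>S. f w \<odot>\<^bsub>A\<^esub> word w)"
  unfolding free_eval_def word_value_def[symmetric] using assms
  by (intro A.add.finprod_mono_neutral_cong_left) (auto simp: subset_iff Pi_iff simp del: in_lists_conv_set)

lemma ev_closed [simp]: "f \<in> carrier F \<Longrightarrow> ev f \<in> carrier A"
  unfolding free_eval_def word_value_def[symmetric]
  by (intro A.finsum_closed) (auto simp: free_algebra_carrier_iff subset_iff Pi_iff simp del: in_lists_conv_set)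

lemma ev_add:
  assumes "f \<in> carrier F" "g \<in> carrier F"
  shows "ev (\<lambda>w. f w \<oplus>\<^bsub>K\<^esub> g w) = ev f \<oplus>\<^bsub>A\<^esub> ev g"
proof -
  let ?S = "{w. f w \<noteq> \<zero>\<^bsub>K\<^esub>} \<union> {w. g w \<noteq> \<zero>\<^bsub>K\<^esub>}"
  have S: "finite ?S" "?S \<subseteq> lists I" and carr: "\<And>w. f w \<in> carrier K" "\<And>w. g w \<in> carrier K"
    using assms by (auto simp: free_algebra_carrier_iff)
  have w: "word w \<in> carrier A" if "w \<in> ?S" for w
    using S(2) that by (intro word_closed) blast
  have "ev (\<lambda>w. f w \<oplus>\<^bsub>K\<^esub> g w) = (\<Oplus>\<^bsub>A\<^esub>w\<in>?S. (f w \<oplus>\<^bsub>K\<^esub> g w) \<odot>\<^bsub>A\<^esub> word w)"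
    using S carr by (intro ev_eq_finsum) auto
  also have "\<dots> = (\<Oplus>\<^bsub>A\<^esub>w\<in>?S. f w \<odot>\<^bsub>A\<^esub> word w \<oplus>\<^bsub>A\<^esub> g w \<odot>\<^bsub>A\<^esub> word w)"
    using carr w by (intro A.finsum_cong') (auto simp: smult_l_distr)
  also have "\<dots> = (\<Oplus>\<^bsub>A\<^esub>w\<in>?S. f w \<odot>\<^bsub>A\<^esub> word w) \<oplus>\<^bsub>A\<^esub> (\<Oplus>\<^bsub>A\<^esub>w\<in>?S. g w \<odot>\<^bsub>A\<^esub> word w)"
    using carr w by (intro A.finsum_addf) auto
  also have "\<dots> = ev f \<oplus>\<^bsub>A\<^esub> ev g"
    using S carr by (intro arg_cong2[of _ _ _ _ "add A"] ev_eq_finsum[symmetric]) auto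
  finally show ?thesis .
qed

lemma scale_closed:
  assumes "c \<in> carrier K" "f \<in> carrier F"
  shows "(\<lambda>w. c \<otimes>\<^bsub>K\<^esub> f w) \<in> carrier F"
  using assms
  by (intro free_algebra_carrierI[of _ _ "{w. f w \<noteq> \<zero>\<^bsub>K\<^esub>}"]) (auto simp: free_algebra_carrier_iff)

lemma ev_scale:
  assumes c: "c \<in> carrier K" and f: "f \<in> carrier F"
  shows "ev (\<lambda>w. c \<otimes>\<^bsub>K\<^esub> f w) = c \<odot>\<^bsub>A\<^esub> ev f"
proof -
  let ?S = "{w. f w \<noteq> \<zero>\<^bsub>K\<^esub>}"
  have S: "finite ?S" "?S \<subseteq> lists I" and carr: "\<And>w. f w \<in> carrier K"
    using f by (auto simp: free_algebra_carrier_iff)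
  have w: "word w \<in> carrier A" if "w \<in> ?S" for w
    using S(2) that by (intro word_closed) blast
  have "ev (\<lambda>w. c \<otimes>\<^bsub>K\<^esub> f w) = (\<Oplus>\<^bsub>A\<^esub>w\<in>?S. (c \<otimes>\<^bsub>K\<^esub> f w) \<odot>\<^bsub>A\<^esub> word w)"
    using S carr c by (intro ev_eq_finsum) auto
  also have "\<dots> = (\<Oplus>\<^bsub>A\<^esub>w\<in>?S. c \<odot>\<^bsub>A\<^esub> (f w \<odot>\<^bsub>A\<^esub> word w))"
    using carr w c by (intro A.finsum_cong') (auto simp: smult_assoc1)
  also have "\<dots> = c \<odot>\<^bsub>A\<^esub> (\<Oplus>\<^bsub>A\<^esub>w\<in>?S. f w \<odot>\<^bsub>A\<^esub> word w)"
    using S(1) carr w c by (intro finsum_smult_ldistr[symmetric]) auto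
  also have "(\<Oplus>\<^bsub>A\<^esub>w\<in>?S. f w \<odot>\<^bsub>A\<^esub> word w) = ev f"
    using S carr by (intro ev_eq_finsum[symmetric]) auto
  finally show ?thesis .
qed

lemma ev_monomial:
  assumes "c \<in> carrier K" "u \<in> lists I"
  shows "ev (monomial K c u) = c \<odot>\<^bsub>A\<^esub> word u"
proof -
  have "ev (monomial K c u) = (\<Oplus>\<^bsub>A\<^esub>w\<in>{u}. monomial K c u w \<odot>\<^bsub>A\<^esub> word w)"
    using assms by (intro ev_eq_finsum) (auto simp: monomial_def)
  also have "\<dots> = c \<odot>\<^bsub>A\<^esub> word u"
    using assms by (subst A.finsum_insert) (auto simp: monomial_def simp del: in_lists_conv_set)
  finally show ?thesis .
qed

text \<open>By this formula \<open>ev_mult\<close> reduces to the multiplicativity of \<open>word\<close> under concatenation.\<close>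

lemma monomial_mult_monomial:
  assumes "c \<in> carrier K" "d \<in> carrier K"
  shows "(monomial K c u \<otimes>\<^bsub>F\<^esub> monomial K d t) w = monomial K (c \<otimes>\<^bsub>K\<^esub> d) (u @ t) w"
  using assms
proof (induction u arbitrary: w)
  case Nil
  then show ?case
    by (subst K.free_algebra_mult_constant_left) (auto simp: monomial_def)
next
  case (Cons x u)
  note [simp] = Cons.prems
  have carr: "monomial K c s r \<in> carrier K" "monomial K d s r \<in> carrier K" for s r :: "'x list"
    by (simp_all add: monomial_def)
  show ?case
  proof (cases w)
    case Nil
    then show ?thesis
      using K.free_algebra_mult_Nil[of "monomial K c (x # u)" "monomial K d t" I, OF carr] carr(2)
      by (simp add: monomial_def)
  next
    case (Cons y w')
    have shift: "(\<lambda>s. monomial K c (x # u) (y # s)) = (if y = x then monomial K c u else (\<lambda>s. \<zero>\<^bsub>K\<^esub>))"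
      by (auto simp: monomial_def)
    have head: "monomial K c (x # u) [] = \<zero>\<^bsub>K\<^esub>"
      by (simp add: monomial_def)
    have "(monomial K c (x # u) \<otimes>\<^bsub>F\<^esub> monomial K d t) (y # w') =
      (if y = x then (monomial K c u \<otimes>\<^bsub>F\<^esub> monomial K d t) w' else \<zero>\<^bsub>K\<^esub>)"
      using carr by (simp add: K.free_algebra_mult_Cons shift head K.free_algebra_mult_zero_left
          K.free_algebra_mult_in_carrier)
    then show ?thesis
      using Cons Cons.IH by (simp add: monomial_def)
  qed
qed

lemma ev_mult:
  assumes "f \<in> carrier F" "g \<in> carrier F"
  shows "ev (f \<otimes>\<^bsub>F\<^esub> g) = ev f \<otimes>\<^bsub>A\<^esub> ev g"
proof -
  interpret F: ring F
    by (rule K.free_algebra_ring)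
  have "ev (monomial K c u \<otimes>\<^bsub>F\<^esub> g) = ev (monomial K c u) \<otimes>\<^bsub>A\<^esub> ev g"
    if c: "c \<in> carrier K" and u: "u \<in> lists I" for c u
    using assms(2)
  proof (induction g rule: K.free_algebra_induct)
    case (monomial d w)
    then show ?case
      using c u monomial_mult_monomial[OF c monomial(1)]
      by (simp add: ev_monomial word_append smult_mult_left smult_mult_right smult_assoc1[symmetric]
          K.m_comm del: in_lists_conv_set)
  next
    case (add g h)
    have m: "monomial K c u \<in> carrier F"
      using c u by (rule K.monomial_closed)
    have "monomial K c u \<otimes>\<^bsub>F\<^esub> (\<lambda>w. g w \<oplus>\<^bsub>K\<^esub> h w) =
        (\<lambda>w. (monomial K c u \<otimes>\<^bsub>F\<^esub> g) w \<oplus>\<^bsub>K\<^esub> (monomial K c u \<otimes>\<^bsub>F\<^esub> h) w)"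
      using F.r_distr[OF add(1,2) m] by simp
    then show ?case
      using add m by (simp add: ev_add A.r_distr)
  qed
  note base = this
  show ?thesis
    using assms(1)
  proof (induction f rule: K.free_algebra_induct)
    case (monomial c w)
    then show ?case
      by (rule base)
  next
    case (add f h)
    have "(\<lambda>w. f w \<oplus>\<^bsub>K\<^esub> h w) \<otimes>\<^bsub>F\<^esub> g = (\<lambda>w. (f \<otimes>\<^bsub>F\<^esub> g) w \<oplus>\<^bsub>K\<^esub> (h \<otimes>\<^bsub>F\<^esub> g) w)"
      using F.l_distr[OF add(1,2) assms(2)] by simp
    then show ?case
      using add assms(2) by (simp add: ev_add A.l_distr)
  qed
qed

lemma ev_one: "ev \<one>\<^bsub>F\<^esub> = \<one>\<^bsub>A\<^esub>"
  using ev_monomial[of "\<one>\<^bsub>K\<^esub>" "[]"] by (simp add: monomial_def)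

end

section \<open>Homogeneous components of evaluations\<close>

locale graded_evaluation = free_evaluation K A a I
  for K :: "('k, 'm) ring_scheme" and A :: "('k, 'a, 'l) module_scheme"
    and a :: "'x \<Rightarrow> 'a" and I :: "'x set" +
  fixes G :: "nat \<Rightarrow> 'a set" and \<delta> :: "'x \<Rightarrow> nat"
  assumes finite_letters: "finite I"
    and grading: "algebra_grading K A G"
    and letter_degree: "i \<in> I \<Longrightarrow> 0 < \<delta> i \<and> a i \<in> G (\<delta> i)"
begin

definition degree :: "'x list \<Rightarrow> nat" where
  "degree w = sum_list (map \<delta> w)"

definition part :: "nat set \<Rightarrow> ('x list \<Rightarrow> 'k) \<Rightarrow> 'x list \<Rightarrow> 'k" where
  "part D f = (\<lambda>w. if degree w \<in> D then f w else \<zero>\<^bsub>K\<^esub>)"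

lemma G_submodule: "submodule (G m) K A"
  using grading by (simp add: algebra_grading_def)

lemma G_zero: "\<zero>\<^bsub>A\<^esub> \<in> G m"
  using subgroup.one_closed[OF submodule.axioms(1)[OF G_submodule]] by simp

lemma G_add: "x \<in> G m \<Longrightarrow> y \<in> G m \<Longrightarrow> x \<oplus>\<^bsub>A\<^esub> y \<in> G m"
  using subgroup.m_closed[OF submodule.axioms(1)[OF G_submodule]] by simp

lemma G_smult: "c \<in> carrier K \<Longrightarrow> x \<in> G m \<Longrightarrow> c \<odot>\<^bsub>A\<^esub> x \<in> G m"
  using submodule.smult_closed[OF G_submodule] by simp

lemma word_homogeneous: "w \<in> lists I \<Longrightarrow> word w \<in> G (degree w)"
proof (induction w)
  case Nil
  then show ?case
    using grading by (simp add: algebra_grading_def degree_def)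
next
  case (Cons i w)
  then have "a i \<in> G (\<delta> i)" "word w \<in> G (degree w)"
    using letter_degree by auto
  then have "a i \<otimes>\<^bsub>A\<^esub> word w \<in> G (\<delta> i + degree w)"
    using grading unfolding algebra_grading_def by blast
  then show ?case
    by (simp add: degree_def)
qed

lemma length_le_degree: "w \<in> lists I \<Longrightarrow> length w \<le> degree w"
proof (induction w)
  case (Cons i w)
  then show ?case
    using letter_degree[of i] by (auto simp: degree_def)
qed (simp add: degree_def)

text \<open>Here the positivity of the degrees enters: the length of a word is bounded by its degree.\<close>

lemma finite_words: "finite {w \<in> lists I. degree w \<le> N}"
proof (rule finite_subset)
  show "{w \<in> lists I. degree w \<le> N} \<subseteq> {w. set w \<subseteq> I \<and> length w \<le> N}"
    using length_le_degree order.trans by (auto simp: in_lists_conv_set)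
  show "finite {w. set w \<subseteq> I \<and> length w \<le> N}"
    using finite_lists_length_le[OF finite_letters] .
qed

lemma part_closed: "f \<in> carrier F \<Longrightarrow> part D f \<in> carrier F"
  by (intro free_algebra_carrierI[of _ _ "{w. f w \<noteq> \<zero>\<^bsub>K\<^esub>}"]) (auto simp: free_algebra_carrier_iff part_def)

lemma part_add: "f \<in> carrier F \<Longrightarrow> g \<in> carrier F \<Longrightarrow>
    part D (\<lambda>w. f w \<oplus>\<^bsub>K\<^esub> g w) = (\<lambda>w. part D f w \<oplus>\<^bsub>K\<^esub> part D g w)"
  by (auto simp: part_def fun_eq_iff)

lemma ev_zero: "ev (\<lambda>w. \<zero>\<^bsub>K\<^esub>) = \<zero>\<^bsub>A\<^esub>"
  by (simp add: free_eval_def)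

lemma ev_part_homogeneous: "f \<in> carrier F \<Longrightarrow> ev (part {m} f) \<in> G m"
proof (induction f rule: K.free_algebra_induct)
  case (monomial c w)
  have "part {m} (monomial K c w) = (if degree w = m then monomial K c w else (\<lambda>w. \<zero>\<^bsub>K\<^esub>))"
    by (auto simp: part_def monomial_def fun_eq_iff)
  then show ?case
    using monomial G_zero G_smult[OF monomial(1) word_homogeneous[OF monomial(2)]]
    by (auto simp: ev_monomial ev_zero simp del: in_lists_conv_set)
next
  case (add f g)
  then show ?case
    by (simp add: part_add ev_add part_closed G_add)
qed

lemma ev_part_eq_finsum:
  assumes "finite D" "f \<in> carrier F"
  shows "ev (part D f) = (\<Oplus>\<^bsub>A\<^esub>m\<in>D. ev (part {m} f))"
  using assms(1)
proof (induction D rule: finite_induct)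
  case empty
  then show ?case
    by (simp add: part_def ev_zero)
next
  case (insert m D)
  have "part (insert m D) f = (\<lambda>w. part {m} f w \<oplus>\<^bsub>K\<^esub> part D f w)"
    using insert.hyps assms(2) by (auto simp: part_def fun_eq_iff free_algebra_carrier_iff)
  then show ?case
    using insert assms(2) by (simp add: ev_add part_closed)
qed

text \<open>The homogeneous components of an element of \<open>A\<close> can be read off from any of its
  representations by a noncommutative polynomial, since the decomposition in \<open>A\<close> is unique.\<close>

lemma ev_part_cong:
  assumes f: "f \<in> carrier F" and g: "g \<in> carrier F" and eq: "ev f = ev g" and "finite D"
  shows "ev (part D f) = ev (part D g)"
proof -
  have decomposition: "(\<forall>m. ev (part {m} h) \<in> G m) \<and> finite {m. ev (part {m} h) \<noteq> \<zero>\<^bsub>A\<^esub>} \<and>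
      ev h = (\<Oplus>\<^bsub>A\<^esub>m\<in>{m. ev (part {m} h) \<noteq> \<zero>\<^bsub>A\<^esub>}. ev (part {m} h))"
    if h: "h \<in> carrier F" for h
  proof -
    let ?D = "degree ` {w. h w \<noteq> \<zero>\<^bsub>K\<^esub>}"
    have D: "finite ?D"
      using h by (simp add: free_algebra_carrier_iff)
    have sub: "{m. ev (part {m} h) \<noteq> \<zero>\<^bsub>A\<^esub>} \<subseteq> ?D"
    proof
      fix m assume m: "m \<in> {m. ev (part {m} h) \<noteq> \<zero>\<^bsub>A\<^esub>}"
      have "part {m} h = (\<lambda>w. \<zero>\<^bsub>K\<^esub>)" if "m \<notin> ?D"
        using that by (auto simp: part_def fun_eq_iff)
      then have "ev (part {m} h) = \<zero>\<^bsub>A\<^esub>" if "m \<notin> ?D"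
        using ev_zero that by simp
      then show "m \<in> ?D"
        using m by blast
    qed
    have "part ?D h = h"
      by (auto simp: part_def fun_eq_iff)
    then have "ev h = ev (part ?D h)"
      by simp
    also have "\<dots> = (\<Oplus>\<^bsub>A\<^esub>m\<in>?D. ev (part {m} h))"
      using D h by (rule ev_part_eq_finsum)
    also have "\<dots> = (\<Oplus>\<^bsub>A\<^esub>m\<in>{m. ev (part {m} h) \<noteq> \<zero>\<^bsub>A\<^esub>}. ev (part {m} h))"
      using D sub h part_closed by (intro A.add.finprod_mono_neutral_cong_right) auto
    finally show ?thesis
      using ev_part_homogeneous[OF h] finite_subset[OF sub D] by blast
  qed
  \<comment> \<open>The components of \<open>f\<close> and those of \<open>g\<close> both decompose the element \<open>ev f\<close>.\<close>
  define P where "P c \<longleftrightarrow> (\<forall>m. c m \<in> G m) \<and> finite {m. c m \<noteq> \<zero>\<^bsub>A\<^esub>} \<and>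
      ev f = (\<Oplus>\<^bsub>A\<^esub>m\<in>{m. c m \<noteq> \<zero>\<^bsub>A\<^esub>}. c m)" for c
  have ex1: "\<exists>!c. P c"
    using grading ev_closed[OF f] unfolding algebra_grading_def P_def by blast
  have Pf: "P (\<lambda>m. ev (part {m} f))"
    unfolding P_def using decomposition[OF f] .
  have Pg: "P (\<lambda>m. ev (part {m} g))"
    unfolding P_def eq using decomposition[OF g] .
  have "ev (part {m} f) = ev (part {m} g)" for m
    using fun_cong[OF trans[OF sym[OF the1_equality[of P, OF ex1 Pf]] the1_equality[of P, OF ex1 Pg]], of m] .
  then show ?thesis
    using ev_part_eq_finsum[OF assms(4) f] ev_part_eq_finsum[OF assms(4) g] by simp
qed

end

section \<open>The lattice of integral combinations of words\<close>

locale valued_evaluation = free_evaluation K A a I + valued_module K v A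
  for K :: "('k, 'm) ring_scheme" and v :: "'k \<Rightarrow> 'g::linordered_ab_group_add with_infty"
    and A :: "('k, 'a, 'l) module_scheme" and a :: "'x \<Rightarrow> 'a" and I :: "'x set"
begin

text \<open>Applied to the valuation ring this is the subring \<open>\<Lambda>\<close> of \<open>A\<close>, and applied to the maximal ideal it
  is \<open>m\<^sub>v \<Lambda>\<close>. Closure properties of both are consequences of closure properties of the set of
  coefficients.\<close>

definition lattice :: "'k set \<Rightarrow> 'a set" where
  "lattice J = ev ` {f \<in> carrier F. \<forall>w. f w \<in> J}"

abbreviation \<Lambda> :: "'a set" where
  "\<Lambda> \<equiv> lattice K.integers"

abbreviation m\<Lambda> :: "'a set" where
  "m\<Lambda> \<equiv> lattice K.nonunits"

lemma latticeI: "f \<in> carrier F \<Longrightarrow> (\<And>w. f w \<in> J) \<Longrightarrow> ev f \<in> lattice J"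
  by (auto simp: lattice_def)

lemma latticeE:
  assumes "x \<in> lattice J"
  obtains f where "f \<in> carrier F" "\<And>w. f w \<in> J" "x = ev f"
  using assms by (auto simp: lattice_def)

lemma lattice_closed: "x \<in> lattice J \<Longrightarrow> x \<in> carrier A"
  by (auto elim!: latticeE)

lemma lattice_add:
  assumes "\<And>c d. c \<in> J \<Longrightarrow> d \<in> J \<Longrightarrow> c \<oplus>\<^bsub>K\<^esub> d \<in> J" "x \<in> lattice J" "y \<in> lattice J"
  shows "x \<oplus>\<^bsub>A\<^esub> y \<in> lattice J"
proof -
  obtain f g where fg: "f \<in> carrier F" "\<And>w. f w \<in> J" "x = ev f" "g \<in> carrier F" "\<And>w. g w \<in> J" "y = ev g"
    using assms(2,3) by (auto elim!: latticeE)
  then have "ev (\<lambda>w. f w \<oplus>\<^bsub>K\<^esub> g w) \<in> lattice J"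
    using assms(1) by (intro latticeI K.free_algebra_add_closed) auto
  then show ?thesis
    using fg by (simp add: ev_add)
qed

lemma lattice_smult:
  assumes "\<And>d. d \<in> J \<Longrightarrow> c \<otimes>\<^bsub>K\<^esub> d \<in> J'" "c \<in> carrier K" "x \<in> lattice J"
  shows "c \<odot>\<^bsub>A\<^esub> x \<in> lattice J'"
proof -
  obtain f where f: "f \<in> carrier F" "\<And>w. f w \<in> J" "x = ev f"
    using assms(3) by (auto elim!: latticeE)
  then have "ev (\<lambda>w. c \<otimes>\<^bsub>K\<^esub> f w) \<in> lattice J'"
    using assms(1,2) by (intro latticeI scale_closed) auto
  then show ?thesis
    using f assms(2) by (simp add: ev_scale)
qed

lemma lattice_mult:
  assumes J: "J\<^sub>1 \<subseteq> carrier K" "J\<^sub>2 \<subseteq> carrier K" "\<And>c d. c \<in> J\<^sub>1 \<Longrightarrow> d \<in> J\<^sub>2 \<Longrightarrow> c \<otimes>\<^bsub>K\<^esub> d \<in> J\<^sub>3"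
    "\<And>c d. c \<in> J\<^sub>3 \<Longrightarrow> d \<in> J\<^sub>3 \<Longrightarrow> c \<oplus>\<^bsub>K\<^esub> d \<in> J\<^sub>3"
    and x: "x \<in> lattice J\<^sub>1" and y: "y \<in> lattice J\<^sub>2"
  shows "x \<otimes>\<^bsub>A\<^esub> y \<in> lattice J\<^sub>3"
proof -
  obtain f where f: "f \<in> carrier F" "\<And>w. f w \<in> J\<^sub>1" "x = ev f"
    using x by (auto elim!: latticeE)
  obtain g where g: "g \<in> carrier F" "\<And>w. g w \<in> J\<^sub>2" "y = ev g"
    using y by (auto elim!: latticeE)
  have "(h \<otimes>\<^bsub>F\<^esub> g) w \<in> J\<^sub>3" if "\<And>w. h w \<in> J\<^sub>1" for h w
    using that
  proof (induction w arbitrary: h)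
    case Nil
    then show ?case
      using K.free_algebra_mult_Nil[of h g I] J g(2) by (auto simp: subset_iff)
  next
    case (Cons x w)
    then show ?case
      using K.free_algebra_mult_Cons[of h g I x w] J g(2) by (auto simp: subset_iff)
  qed
  then have "ev (f \<otimes>\<^bsub>F\<^esub> g) \<in> lattice J\<^sub>3"
    using f g by (intro latticeI K.free_algebra_mult_closed) auto
  then show ?thesis
    using f g by (simp add: ev_mult)
qed

lemma integers_subset: "K.integers \<subseteq> carrier K"
  by (auto simp: K.integers_iff)

lemma nonunits_subset_carrier: "K.nonunits \<subseteq> carrier K"
  by (auto simp: K.nonunits_iff)

lemma nonunits_mult_integers: "c \<in> K.nonunits \<Longrightarrow> d \<in> K.integers \<Longrightarrow> c \<otimes>\<^bsub>K\<^esub> d \<in> K.nonunits"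
  using K.nonunits_closed(3)[of d c] by (simp add: K.nonunits_iff K.integers_iff K.m_comm)

lemma \<Lambda>_closed:
  "w \<in> lists I \<Longrightarrow> word w \<in> \<Lambda>"
  "x \<in> \<Lambda> \<Longrightarrow> y \<in> \<Lambda> \<Longrightarrow> x \<oplus>\<^bsub>A\<^esub> y \<in> \<Lambda>"
  "x \<in> \<Lambda> \<Longrightarrow> y \<in> \<Lambda> \<Longrightarrow> x \<otimes>\<^bsub>A\<^esub> y \<in> \<Lambda>"
  "c \<in> K.integers \<Longrightarrow> x \<in> \<Lambda> \<Longrightarrow> c \<odot>\<^bsub>A\<^esub> x \<in> \<Lambda>"
proof -
  show "word w \<in> \<Lambda>" if "w \<in> lists I"
  proof -
    have "ev (monomial K \<one>\<^bsub>K\<^esub> w) \<in> \<Lambda>"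
      using that K.integers_closed by (intro latticeI K.monomial_closed) (auto simp: monomial_def)
    then show ?thesis
      using that by (simp add: ev_monomial del: in_lists_conv_set)
  qed
  show "x \<oplus>\<^bsub>A\<^esub> y \<in> \<Lambda>" if "x \<in> \<Lambda>" "y \<in> \<Lambda>"
    using K.integers_closed(5) that by (rule lattice_add)
  show "x \<otimes>\<^bsub>A\<^esub> y \<in> \<Lambda>" if "x \<in> \<Lambda>" "y \<in> \<Lambda>"
    using integers_subset integers_subset K.integers_closed(4,5) that by (rule lattice_mult)
  show "c \<odot>\<^bsub>A\<^esub> x \<in> \<Lambda>" if "c \<in> K.integers" "x \<in> \<Lambda>"
    using that integers_subset by (intro lattice_smult[of K.integers]) (auto intro: K.integers_closed)
qed

lemma m\<Lambda>_closed:
  "\<zero>\<^bsub>A\<^esub> \<in> m\<Lambda>"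
  "x \<in> m\<Lambda> \<Longrightarrow> y \<in> m\<Lambda> \<Longrightarrow> x \<oplus>\<^bsub>A\<^esub> y \<in> m\<Lambda>"
  "x \<in> m\<Lambda> \<Longrightarrow> y \<in> \<Lambda> \<Longrightarrow> x \<otimes>\<^bsub>A\<^esub> y \<in> m\<Lambda>"
  "x \<in> \<Lambda> \<Longrightarrow> y \<in> m\<Lambda> \<Longrightarrow> x \<otimes>\<^bsub>A\<^esub> y \<in> m\<Lambda>"
  "c \<in> K.nonunits \<Longrightarrow> x \<in> \<Lambda> \<Longrightarrow> c \<odot>\<^bsub>A\<^esub> x \<in> m\<Lambda>"
  "c \<in> K.integers \<Longrightarrow> x \<in> m\<Lambda> \<Longrightarrow> c \<odot>\<^bsub>A\<^esub> x \<in> m\<Lambda>"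
proof -
  have "ev (\<lambda>w. \<zero>\<^bsub>K\<^esub>) \<in> m\<Lambda>"
    by (intro latticeI) (auto simp: free_algebra_carrier_iff K.nonunits_closed)
  then show "\<zero>\<^bsub>A\<^esub> \<in> m\<Lambda>"
    by (simp add: free_eval_def)
  show "x \<oplus>\<^bsub>A\<^esub> y \<in> m\<Lambda>" if "x \<in> m\<Lambda>" "y \<in> m\<Lambda>"
    using K.nonunits_closed(4) that by (rule lattice_add)
  show "x \<otimes>\<^bsub>A\<^esub> y \<in> m\<Lambda>" if "x \<in> m\<Lambda>" "y \<in> \<Lambda>"
    using nonunits_subset_carrier integers_subset nonunits_mult_integers K.nonunits_closed(4) that
    by (rule lattice_mult)
  show "x \<otimes>\<^bsub>A\<^esub> y \<in> m\<Lambda>" if "x \<in> \<Lambda>" "y \<in> m\<Lambda>"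
    using integers_subset nonunits_subset_carrier K.nonunits_closed(3,4) that by (rule lattice_mult)
  show "c \<odot>\<^bsub>A\<^esub> x \<in> m\<Lambda>" if "c \<in> K.nonunits" "x \<in> \<Lambda>"
    using that nonunits_subset_carrier
    by (intro lattice_smult[of K.integers]) (auto intro: nonunits_mult_integers)
  show "c \<odot>\<^bsub>A\<^esub> x \<in> m\<Lambda>" if "c \<in> K.integers" "x \<in> m\<Lambda>"
    using that integers_subset
    by (intro lattice_smult[of K.nonunits]) (auto intro: K.nonunits_closed)
qed

lemma minus_eq_smult: "x \<in> carrier A \<Longrightarrow> \<ominus>\<^bsub>A\<^esub> x = (\<ominus>\<^bsub>K\<^esub> \<one>\<^bsub>K\<^esub>) \<odot>\<^bsub>A\<^esub> x"
  by (simp add: smult_l_minus)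

lemma minus_one_integer: "\<ominus>\<^bsub>K\<^esub> \<one>\<^bsub>K\<^esub> \<in> K.integers"
  by (intro K.integers_closed)

lemma m\<Lambda>_subset: "m\<Lambda> \<subseteq> \<Lambda>"
  using K.nonunits_subset by (auto elim!: latticeE intro!: latticeI)

end

section \<open>The Gauss valuation\<close>

text \<open>The last two assumptions say that \<open>\<Lambda> / m\<^sub>v \<Lambda>\<close> is a domain.\<close>

locale gauss_valuation = graded_evaluation K A a I G \<delta> + valued_evaluation K v A a I
  for K :: "('k, 'm) ring_scheme" and v :: "'k \<Rightarrow> 'g::linordered_ab_group_add with_infty"
    and A :: "('k, 'a, 'l) module_scheme" and a :: "'x \<Rightarrow> 'a" and I :: "'x set"
    and G :: "nat \<Rightarrow> 'a set" and \<delta> :: "'x \<Rightarrow> nat" +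
  assumes generated: "carrier A \<subseteq> ev ` carrier F"
    and one_notin: "\<one>\<^bsub>A\<^esub> \<notin> m\<Lambda>"
    and prime: "x \<in> \<Lambda> \<Longrightarrow> y \<in> \<Lambda> \<Longrightarrow> x \<otimes>\<^bsub>A\<^esub> y \<in> m\<Lambda> \<Longrightarrow> x \<in> m\<Lambda> \<or> y \<in> m\<Lambda>"
begin

text \<open>Only finitely many words have bounded degree, and truncation in the degree is compatible
  with evaluation. So a primitive element for the lattice spanned by the words in a suitable finite
  set \<open>T\<close> is still primitive in \<open>\<Lambda>\<close>.\<close>

lemma ex_primitive_multiple:
  assumes "x \<in> carrier A" "x \<noteq> \<zero>\<^bsub>A\<^esub>"
  obtains c y where "c \<in> carrier K" "c \<noteq> \<zero>\<^bsub>K\<^esub>" "y \<in> \<Lambda>" "y \<notin> m\<Lambda>" "x = c \<odot>\<^bsub>A\<^esub> y"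
proof -
  obtain f where f: "f \<in> carrier F" "x = ev f"
    using generated assms(1) by auto
  define N where "N = Max (insert 0 (degree ` {w. f w \<noteq> \<zero>\<^bsub>K\<^esub>}))"
  define T where "T = {w \<in> lists I. degree w \<le> N}"
  have T: "finite T" "T \<subseteq> lists I" "word \<in> T \<rightarrow> carrier A"
    using finite_words by (auto simp: T_def simp del: in_lists_conv_set)
  have "degree w \<le> N" if "f w \<noteq> \<zero>\<^bsub>K\<^esub>" for w
    using f(1) that unfolding N_def by (intro Max_ge) (auto simp: free_algebra_carrier_iff)
  then have "{w. f w \<noteq> \<zero>\<^bsub>K\<^esub>} \<subseteq> T"
    using f(1) unfolding T_def free_algebra_carrier_iff by blast
  then have "x = (\<Oplus>\<^bsub>A\<^esub>w\<in>T. f w \<odot>\<^bsub>A\<^esub> word w)"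
    using f T by (auto simp: free_algebra_carrier_iff intro!: ev_eq_finsum)
  then have "x \<in> combinations word (carrier K) T"
    using f(1) unfolding combinations_def by (auto simp: free_algebra_carrier_iff)
  then obtain c y where cy: "c \<in> carrier K" "c \<noteq> \<zero>\<^bsub>K\<^esub>" "y \<in> combinations word K.integers T"
      "x = c \<odot>\<^bsub>A\<^esub> y" "y \<notin> combinations word K.nonunits T"
    using primitive_multiple[OF T(1,3) _ assms(2)] by blast
  obtain d where d: "d \<in> T \<rightarrow> K.integers" "y = (\<Oplus>\<^bsub>A\<^esub>w\<in>T. d w \<odot>\<^bsub>A\<^esub> word w)"
    using cy(3) by (auto simp: combinations_def)
  define g where "g w = (if w \<in> T then d w else \<zero>\<^bsub>K\<^esub>)" for w
  have gO: "g w \<in> K.integers" for w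
    using d(1) K.integers_closed(1) by (auto simp: g_def)
  then have gK: "g w \<in> carrier K" for w
    using integers_subset by blast
  have supp: "{w. g w \<noteq> \<zero>\<^bsub>K\<^esub>} \<subseteq> T"
    by (auto simp: g_def)
  have gF: "g \<in> carrier F"
    using gK supp T(1,2) by (rule free_algebra_carrierI)
  have "ev g = (\<Oplus>\<^bsub>A\<^esub>w\<in>T. g w \<odot>\<^bsub>A\<^esub> word w)"
    using gK T(1,2) supp by (rule ev_eq_finsum)
  also have "\<dots> = y"
    unfolding d(2) using d(1) integers_subset T(3) by (intro A.finsum_cong') (auto simp: g_def Pi_iff)
  finally have evg: "ev g = y" .
  have "y \<notin> m\<Lambda>"
  proof
    assume "y \<in> m\<Lambda>"
    then obtain h where h: "h \<in> carrier F" "\<And>w. h w \<in> K.nonunits" "y = ev h"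
      by (auto elim!: latticeE)
    \<comment> \<open>Truncating a representation of \<open>y\<close> over the maximal ideal gives one that uses only words in \<open>T\<close>.\<close>
    have "part {..N} g = g"
      by (auto simp: part_def g_def T_def fun_eq_iff)
    then have "y = ev (part {..N} h)"
      using ev_part_cong[OF h(1) gF, of "{..N}"] evg h(3) by simp
    also have "\<dots> = (\<Oplus>\<^bsub>A\<^esub>w\<in>T. part {..N} h w \<odot>\<^bsub>A\<^esub> word w)"
    proof (rule ev_eq_finsum)
      show "{w. part {..N} h w \<noteq> \<zero>\<^bsub>K\<^esub>} \<subseteq> T"
        using h(1) unfolding T_def free_algebra_carrier_iff by (auto simp: part_def subset_iff split: if_splits)
    qed (use part_closed[OF h(1)] T in \<open>auto simp: free_algebra_carrier_iff\<close>)
    also have "\<dots> \<in> combinations word K.nonunits T"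
      using h(2) K.nonunits_closed(1) unfolding combinations_def
      by (intro CollectI exI[of _ "part {..N} h"]) (auto simp: part_def)
    finally show False
      using cy(5) by simp
  qed
  moreover have "y \<in> \<Lambda>"
    unfolding evg[symmetric] using gF gO by (rule latticeI)
  ultimately show thesis
    using that cy by blast
qed

text \<open>The value of the scalar in front of a primitive element is the largest possible. Otherwise
  cancelling the smaller scalar would exhibit the primitive element as a multiple by a nonunit.\<close>

lemma primitive_value_le:
  assumes "c \<in> carrier K" "c \<noteq> \<zero>\<^bsub>K\<^esub>" "y \<in> \<Lambda>" "y \<notin> m\<Lambda>" "c' \<in> carrier K" "y' \<in> \<Lambda>"
    "c \<odot>\<^bsub>A\<^esub> y = c' \<odot>\<^bsub>A\<^esub> y'"
  shows "v c' \<le> v c"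
proof (rule ccontr)
  assume "\<not> v c' \<le> v c"
  then have "v c < v c'"
    by simp
  then obtain z where z: "z \<in> carrier K" "c' = c \<otimes>\<^bsub>K\<^esub> z" "0 < v z"
    using K.factor_through[OF assms(1,2,5)] by metis
  note [simp] = lattice_closed[OF assms(3)] lattice_closed[OF assms(6)]
  have "y = inv\<^bsub>K\<^esub> c \<odot>\<^bsub>A\<^esub> (c \<odot>\<^bsub>A\<^esub> y)"
    using K.nonzero_inverse[OF assms(1,2)] assms(1) by (simp add: smult_assoc1[symmetric])
  also have "\<dots> = z \<odot>\<^bsub>A\<^esub> y'"
    using K.nonzero_inverse[OF assms(1,2)] assms(1) z
    by (simp add: assms(7) smult_assoc1[symmetric] K.m_assoc[symmetric])
  also have "\<dots> \<in> m\<Lambda>"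
    using z assms(6) by (intro m\<Lambda>_closed) (simp_all add: K.nonunits_iff)
  finally show False
    using assms(4) by simp
qed

definition gauss :: "'a \<Rightarrow> 'g with_infty" where
  "gauss x = (if x = \<zero>\<^bsub>A\<^esub> then Infty else
     (SOME r. \<exists>c y. c \<in> carrier K \<and> c \<noteq> \<zero>\<^bsub>K\<^esub> \<and> y \<in> \<Lambda> \<and> y \<notin> m\<Lambda> \<and> x = c \<odot>\<^bsub>A\<^esub> y \<and> r = v c))"

lemma smult_primitive_nonzero:
  assumes "c \<in> carrier K" "c \<noteq> \<zero>\<^bsub>K\<^esub>" "y \<in> \<Lambda>" "y \<notin> m\<Lambda>"
  shows "c \<odot>\<^bsub>A\<^esub> y \<noteq> \<zero>\<^bsub>A\<^esub>"
proof
  assume "c \<odot>\<^bsub>A\<^esub> y = \<zero>\<^bsub>A\<^esub>"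
  then have "v \<zero>\<^bsub>K\<^esub> \<le> v c"
    using assms lattice_closed by (intro primitive_value_le[of c y "\<zero>\<^bsub>K\<^esub>" y]) auto
  then show False
    using K.v_eq_Infty_iff[OF assms(1)] assms(2) by (cases "v c") auto
qed

lemma gauss_primitive:
  assumes "c \<in> carrier K" "c \<noteq> \<zero>\<^bsub>K\<^esub>" "y \<in> \<Lambda>" "y \<notin> m\<Lambda>"
  shows "gauss (c \<odot>\<^bsub>A\<^esub> y) = v c"
proof -
  have "(SOME r. \<exists>c' y'. c' \<in> carrier K \<and> c' \<noteq> \<zero>\<^bsub>K\<^esub> \<and> y' \<in> \<Lambda> \<and> y' \<notin> m\<Lambda> \<and>
      c \<odot>\<^bsub>A\<^esub> y = c' \<odot>\<^bsub>A\<^esub> y' \<and> r = v c') = v c"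
  proof (rule some_equality)
    fix r assume "\<exists>c' y'. c' \<in> carrier K \<and> c' \<noteq> \<zero>\<^bsub>K\<^esub> \<and> y' \<in> \<Lambda> \<and> y' \<notin> m\<Lambda> \<and>
      c \<odot>\<^bsub>A\<^esub> y = c' \<odot>\<^bsub>A\<^esub> y' \<and> r = v c'"
    then obtain c' y' where c': "c' \<in> carrier K" "c' \<noteq> \<zero>\<^bsub>K\<^esub>" "y' \<in> \<Lambda>" "y' \<notin> m\<Lambda>"
      "c \<odot>\<^bsub>A\<^esub> y = c' \<odot>\<^bsub>A\<^esub> y'" "r = v c'"
      by blast
    then show "r = v c"
      using primitive_value_le[of c y c' y'] primitive_value_le[of c' y' c y] assms by auto
  qed (use assms in blast)
  then show ?thesis
    using smult_primitive_nonzero[OF assms] by (simp add: gauss_def)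
qed

text \<open>Any scalar that can be taken out of an element, primitive cofactor or not, bounds its value
  from below. This yields the ultrametric inequality.\<close>

lemma gauss_ge:
  assumes "c \<in> carrier K" "y \<in> \<Lambda>"
  shows "v c \<le> gauss (c \<odot>\<^bsub>A\<^esub> y)"
proof (cases "c \<odot>\<^bsub>A\<^esub> y = \<zero>\<^bsub>A\<^esub>")
  case True
  then show ?thesis
    by (simp add: gauss_def)
next
  case False
  obtain d z where dz: "d \<in> carrier K" "d \<noteq> \<zero>\<^bsub>K\<^esub>" "z \<in> \<Lambda>" "z \<notin> m\<Lambda>" "c \<odot>\<^bsub>A\<^esub> y = d \<odot>\<^bsub>A\<^esub> z"
    using ex_primitive_multiple[OF _ False] lattice_closed[OF assms(2)] assms(1) by auto
  then show ?thesis
    using primitive_value_le[of d z c y] assms by (simp add: gauss_primitive)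
qed

lemma gauss_add:
  assumes "x \<in> carrier A" "y \<in> carrier A"
  shows "min (gauss x) (gauss y) \<le> gauss (x \<oplus>\<^bsub>A\<^esub> y)"
proof -
  have ordered: "v c \<le> gauss (c \<odot>\<^bsub>A\<^esub> x' \<oplus>\<^bsub>A\<^esub> d \<odot>\<^bsub>A\<^esub> y')"
    if c: "c \<in> carrier K" "c \<noteq> \<zero>\<^bsub>K\<^esub>" and d: "d \<in> carrier K" and xy: "x' \<in> \<Lambda>" "y' \<in> \<Lambda>"
      and le: "v c \<le> v d" for c d x' y'
  proof -
    obtain z where z: "z \<in> carrier K" "d = c \<otimes>\<^bsub>K\<^esub> z" "0 \<le> v z"
      using K.factor_through[OF c d] le by metis
    have "c \<odot>\<^bsub>A\<^esub> x' \<oplus>\<^bsub>A\<^esub> d \<odot>\<^bsub>A\<^esub> y' = c \<odot>\<^bsub>A\<^esub> (x' \<oplus>\<^bsub>A\<^esub> z \<odot>\<^bsub>A\<^esub> y')"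
      using c xy z lattice_closed by (simp add: smult_assoc1 smult_r_distr)
    moreover have "x' \<oplus>\<^bsub>A\<^esub> z \<odot>\<^bsub>A\<^esub> y' \<in> \<Lambda>"
      using xy z by (intro \<Lambda>_closed) (simp_all add: K.integers_iff)
    ultimately show ?thesis
      using gauss_ge c(1) by simp
  qed
  show ?thesis
  proof (cases "x = \<zero>\<^bsub>A\<^esub> \<or> y = \<zero>\<^bsub>A\<^esub>")
    case True
    then show ?thesis
      using assms by (auto simp: min_le_iff_disj)
  next
    case False
    obtain c x' where x: "c \<in> carrier K" "c \<noteq> \<zero>\<^bsub>K\<^esub>" "x' \<in> \<Lambda>" "x' \<notin> m\<Lambda>" "x = c \<odot>\<^bsub>A\<^esub> x'"
      using ex_primitive_multiple assms(1) False by metis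
    obtain d y' where y: "d \<in> carrier K" "d \<noteq> \<zero>\<^bsub>K\<^esub>" "y' \<in> \<Lambda>" "y' \<notin> m\<Lambda>" "y = d \<odot>\<^bsub>A\<^esub> y'"
      using ex_primitive_multiple assms(2) False by metis
    have "gauss x = v c" "gauss y = v d"
      using x y gauss_primitive by auto
    then show ?thesis
      using ordered[of c d x' y'] ordered[of d c y' x'] x y assms
      by (cases "v c \<le> v d") (auto simp: min_le_iff_disj A.a_comm)
  qed
qed

lemma gauss_mult:
  assumes "x \<in> carrier A" "y \<in> carrier A"
  shows "gauss (x \<otimes>\<^bsub>A\<^esub> y) = gauss x + gauss y"
proof (cases "x = \<zero>\<^bsub>A\<^esub> \<or> y = \<zero>\<^bsub>A\<^esub>")
  case True
  then have "gauss x = Infty \<or> gauss y = Infty" "x \<otimes>\<^bsub>A\<^esub> y = \<zero>\<^bsub>A\<^esub>"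
    using assms by (auto simp: gauss_def)
  then show ?thesis
    using add_eq_Infty_iff[of "gauss x" "gauss y"] by (simp add: gauss_def)
next
  case False
  obtain c x' where x: "c \<in> carrier K" "c \<noteq> \<zero>\<^bsub>K\<^esub>" "x' \<in> \<Lambda>" "x' \<notin> m\<Lambda>" "x = c \<odot>\<^bsub>A\<^esub> x'"
    using ex_primitive_multiple assms(1) False by metis
  obtain d y' where y: "d \<in> carrier K" "d \<noteq> \<zero>\<^bsub>K\<^esub>" "y' \<in> \<Lambda>" "y' \<notin> m\<Lambda>" "y = d \<odot>\<^bsub>A\<^esub> y'"
    using ex_primitive_multiple assms(2) False by metis
  have xy: "x \<otimes>\<^bsub>A\<^esub> y = (c \<otimes>\<^bsub>K\<^esub> d) \<odot>\<^bsub>A\<^esub> (x' \<otimes>\<^bsub>A\<^esub> y')"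
  proof -
    have carr: "x' \<in> carrier A" "y' \<in> carrier A"
      using x(3) y(3) lattice_closed by blast+
    then have "x \<otimes>\<^bsub>A\<^esub> y = c \<odot>\<^bsub>A\<^esub> (x' \<otimes>\<^bsub>A\<^esub> (d \<odot>\<^bsub>A\<^esub> y'))"
      unfolding x(5) y(5) using x(1) y(1) by (intro smult_mult_left) auto
    also have "x' \<otimes>\<^bsub>A\<^esub> (d \<odot>\<^bsub>A\<^esub> y') = d \<odot>\<^bsub>A\<^esub> (x' \<otimes>\<^bsub>A\<^esub> y')"
      using carr y(1) by (intro smult_mult_right)
    finally show ?thesis
      using carr x(1) y(1) by (simp add: smult_assoc1)
  qed
  have "x' \<otimes>\<^bsub>A\<^esub> y' \<in> \<Lambda>" "x' \<otimes>\<^bsub>A\<^esub> y' \<notin> m\<Lambda>"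
    using x y prime \<Lambda>_closed(3) by blast+
  moreover have "c \<otimes>\<^bsub>K\<^esub> d \<noteq> \<zero>\<^bsub>K\<^esub>"
    using K.integral x y by blast
  ultimately have "gauss (x \<otimes>\<^bsub>A\<^esub> y) = v (c \<otimes>\<^bsub>K\<^esub> d)"
    using x(1) y(1) gauss_primitive by (simp add: xy)
  then show ?thesis
    using x y by (simp add: gauss_primitive K.v_mult)
qed

lemma gauss_eq_Infty_iff:
  assumes "x \<in> carrier A"
  shows "gauss x = Infty \<longleftrightarrow> x = \<zero>\<^bsub>A\<^esub>"
proof (cases "x = \<zero>\<^bsub>A\<^esub>")
  case False
  then obtain c y where "c \<in> carrier K" "c \<noteq> \<zero>\<^bsub>K\<^esub>" "y \<in> \<Lambda>" "y \<notin> m\<Lambda>" "x = c \<odot>\<^bsub>A\<^esub> y"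
    using ex_primitive_multiple assms by metis
  then show ?thesis
    using False gauss_primitive K.v_eq_Infty_iff by auto
qed (simp add: gauss_def)

lemma ring_valuation_gauss: "ring_valuation A gauss"
  using gauss_eq_Infty_iff gauss_mult gauss_add by (simp add: ring_valuation_def)

lemma gauss_scalar:
  assumes "c \<in> carrier K"
  shows "gauss (c \<odot>\<^bsub>A\<^esub> \<one>\<^bsub>A\<^esub>) = v c"
proof (cases "c = \<zero>\<^bsub>K\<^esub>")
  case False
  have "\<one>\<^bsub>A\<^esub> \<in> \<Lambda>"
    using \<Lambda>_closed(1)[of "[]"] by simp
  then show ?thesis
    using gauss_primitive[OF assms False _ one_notin] by simp
qed (simp add: gauss_def)

end

section \<open>The reduction of the lattice\<close>

context valued_field
begin

lemma valuation_ring_minus: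
  assumes "x \<in> integers"
  shows "\<ominus>\<^bsub>valuation_ring K v\<^esub> x = \<ominus> x"
proof -
  interpret V: ring "valuation_ring K v"
    by (rule ring_valuation_ring)
  show ?thesis
  proof (rule V.minus_equality)
    show "\<ominus> x \<oplus>\<^bsub>valuation_ring K v\<^esub> x = \<zero>\<^bsub>valuation_ring K v\<^esub>"
      using assms by (simp add: l_neg integers_iff)
  qed (use assms in \<open>simp_all add: integers_closed\<close>)
qed

lemma coset_eq_iff:
  assumes "x \<in> integers" "y \<in> integers"
  shows "nonunits +>\<^bsub>valuation_ring K v\<^esub> x = nonunits +>\<^bsub>valuation_ring K v\<^esub> y \<longleftrightarrow> x \<ominus> y \<in> nonunits"
proof -
  interpret ideal nonunits "valuation_ring K v"
    by (rule ideal_max_ideal)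
  have "nonunits +>\<^bsub>valuation_ring K v\<^esub> x = nonunits +>\<^bsub>valuation_ring K v\<^esub> y \<longleftrightarrow>
      x \<in> nonunits +>\<^bsub>valuation_ring K v\<^esub> y"
    using a_repr_independence'[OF _ assms(2), of x] a_rcos_self[OF assms(1)] by auto
  also have "\<dots> \<longleftrightarrow> x \<ominus>\<^bsub>valuation_ring K v\<^esub> y \<in> nonunits"
    using ring_axioms assms(2,1) by (rule a_rcos_module_minus)
  also have "x \<ominus>\<^bsub>valuation_ring K v\<^esub> y = x \<ominus> y"
    using assms(2) by (simp add: a_minus_def valuation_ring_minus)
  finally show ?thesis .
qed

lemma ring_residue_field: "ring (residue_field K v)"
  unfolding residue_field_def using ideal_max_ideal by (rule ideal.quotient_is_ring)

lemma coeff_residue_hom: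
  "coeff_residue K v \<in> ring_hom (free_algebra (valuation_ring K v) I) (free_algebra (residue_field K v) I)"
proof -
  have "(\<lambda>f w. nonunits +>\<^bsub>valuation_ring K v\<^esub> f w) \<in>
      ring_hom (free_algebra (valuation_ring K v) I) (free_algebra (residue_field K v) I)"
    using ring_valuation_ring ring_residue_field ideal.rcos_ring_hom[OF ideal_max_ideal]
    unfolding residue_field_def by (rule free_algebra_map_hom)
  then show ?thesis
    by (simp add: coeff_residue_def[abs_def])
qed

lemma free_algebra_valuation_ring:
  "carrier (free_algebra (valuation_ring K v) I) = {f \<in> carrier (free_algebra K I). \<forall>w. f w \<in> integers}"
  by (rule Set.set_eqI) (simp add: free_algebra_carrier_iff integers_iff, blast)

text \<open>The two products are sums over different rings; they agree because the inclusion of the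
  valuation ring into \<open>K\<close> is a homomorphism.\<close>

lemma free_algebra_valuation_ring_mult:
  assumes "f \<in> carrier (free_algebra (valuation_ring K v) I)" "g \<in> carrier (free_algebra (valuation_ring K v) I)"
  shows "f \<otimes>\<^bsub>free_algebra (valuation_ring K v) I\<^esub> g = f \<otimes>\<^bsub>free_algebra K I\<^esub> g"
proof -
  have "(\<lambda>x. x) \<in> ring_hom (valuation_ring K v) K"
    by (rule ring_hom_memI) (auto simp: integers_iff)
  then have "(\<lambda>f w. f w) \<in> ring_hom (free_algebra (valuation_ring K v) I) (free_algebra K I)"
    by (rule free_algebra_map_hom[OF ring_valuation_ring ring_axioms])
  from ring_hom_mult[OF this assms] show ?thesis
    by simp
qed

end

context valued_evaluation
begin

lemma \<Lambda>_eq: "ev ` carrier (free_algebra (valuation_ring K v) I) = \<Lambda>"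
  by (simp add: lattice_def K.free_algebra_valuation_ring)

lemma generate_eq_m\<Lambda>:
  "generate (add_monoid A) {c \<odot>\<^bsub>A\<^esub> x | c x. c \<in> K.nonunits \<and> x \<in> \<Lambda>} = m\<Lambda>" (is "generate _ ?S = _")
proof
  show "generate (add_monoid A) ?S \<subseteq> m\<Lambda>"
  proof
    fix x assume "x \<in> generate (add_monoid A) ?S"
    then show "x \<in> m\<Lambda>"
    proof (induction rule: generate.induct)
      case (inv h)
      then have "h \<in> m\<Lambda>"
        by (auto intro: m\<Lambda>_closed)
      then have "(\<ominus>\<^bsub>K\<^esub> \<one>\<^bsub>K\<^esub>) \<odot>\<^bsub>A\<^esub> h \<in> m\<Lambda>"
        using minus_one_integer by (intro m\<Lambda>_closed)
      then show ?case
        using minus_eq_smult[OF lattice_closed[OF \<open>h \<in> m\<Lambda>\<close>]] by (simp add: a_inv_def)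
    qed (auto intro: m\<Lambda>_closed)
  qed
next
  show "m\<Lambda> \<subseteq> generate (add_monoid A) ?S"
  proof
    fix x assume "x \<in> m\<Lambda>"
    then obtain f where f: "f \<in> carrier F" "\<And>w. f w \<in> K.nonunits" "x = ev f"
      by (auto elim!: latticeE)
    have "(\<Oplus>\<^bsub>A\<^esub>w\<in>S. f w \<odot>\<^bsub>A\<^esub> word w) \<in> generate (add_monoid A) ?S" if "finite S" "S \<subseteq> lists I" for S
      using that
    proof (induction S rule: finite_induct)
      case empty
      then show ?case
        using generate.one[of "add_monoid A"] by simp
    next
      case (insert u S)
      have carr: "f w \<in> carrier K" for w
        using f(1) by (simp add: free_algebra_carrier_iff)
      have "f u \<odot>\<^bsub>A\<^esub> word u \<in> ?S"
        using f(2) \<Lambda>_closed(1) insert.prems by blast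
      then have "f u \<odot>\<^bsub>A\<^esub> word u \<in> generate (add_monoid A) ?S"
        by (rule generate.incl)
      then have "f u \<odot>\<^bsub>A\<^esub> word u \<oplus>\<^bsub>A\<^esub> (\<Oplus>\<^bsub>A\<^esub>w\<in>S. f w \<odot>\<^bsub>A\<^esub> word w) \<in> generate (add_monoid A) ?S"
        using generate.eng[of _ "add_monoid A"] insert by simp
      moreover have "(\<lambda>w. f w \<odot>\<^bsub>A\<^esub> word w) \<in> insert u S \<rightarrow> carrier A"
        using carr insert.prems by (intro Pi_I smult_closed word_closed) auto
      ultimately show ?case
        using insert by (subst A.finsum_insert) auto
    qed
    moreover have "x = (\<Oplus>\<^bsub>A\<^esub>w\<in>{w. f w \<noteq> \<zero>\<^bsub>K\<^esub>}. f w \<odot>\<^bsub>A\<^esub> word w)"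
      using f by (simp add: free_eval_def word_value_def)
    ultimately show "x \<in> generate (add_monoid A) ?S"
      using f(1) by (simp add: free_algebra_carrier_iff)
  qed
qed

text \<open>Both \<open>\<Lambda>\<close> and \<open>m\<^sub>v \<Lambda>\<close> are \<open>O\<^sub>v\<close>-modules, so closure under negation is closure under the scalar
  \<open>-1\<close>.\<close>

lemma ideal_m\<Lambda>: "ideal m\<Lambda> (A\<lparr>carrier := \<Lambda>\<rparr>)"
proof -
  have neg: "\<ominus>\<^bsub>A\<^esub> x \<in> \<Lambda>" if "x \<in> \<Lambda>" for x
    using minus_eq_smult[OF lattice_closed[OF that]] \<Lambda>_closed(4)[OF minus_one_integer that] by simp
  have neg': "\<ominus>\<^bsub>A\<^esub> x \<in> m\<Lambda>" if "x \<in> m\<Lambda>" for x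
    using minus_eq_smult[OF lattice_closed[OF that]] m\<Lambda>_closed(6)[OF minus_one_integer that] by simp
  have ring: "ring (A\<lparr>carrier := \<Lambda>\<rparr>)"
    using lattice_closed \<Lambda>_closed(1)[of "[]"] neg \<Lambda>_closed(2,3) by (intro A.ring_restrict) auto
  show ?thesis
  proof (rule idealI[OF ring])
    interpret L: ring "A\<lparr>carrier := \<Lambda>\<rparr>"
      by (rule ring)
    have "\<ominus>\<^bsub>A\<lparr>carrier := \<Lambda>\<rparr>\<^esub> x = \<ominus>\<^bsub>A\<^esub> x" if "x \<in> \<Lambda>" for x
      using that neg lattice_closed[OF that] by (intro L.minus_equality) (simp_all add: A.l_neg)
    then show "subgroup m\<Lambda> (add_monoid (A\<lparr>carrier := \<Lambda>\<rparr>))"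
      using m\<Lambda>_subset m\<Lambda>_closed(1,2) neg' by (intro L.add.subgroupI) (auto simp: subset_iff)
  qed (use m\<Lambda>_closed in auto)
qed

lemma nc_domain_reduction_iff:
  "nc_domain (A\<lparr>carrier := \<Lambda>\<rparr> Quot m\<Lambda>) \<longleftrightarrow>
    \<one>\<^bsub>A\<^esub> \<notin> m\<Lambda> \<and> (\<forall>x\<in>\<Lambda>. \<forall>y\<in>\<Lambda>. x \<otimes>\<^bsub>A\<^esub> y \<in> m\<Lambda> \<longrightarrow> x \<in> m\<Lambda> \<or> y \<in> m\<Lambda>)"
  using nc_domain_Quot_iff[OF ideal_m\<Lambda>] by simp

section \<open>Good reduction\<close>

lemma ev_diff:
  assumes "f \<in> carrier F" "g \<in> carrier F"
  shows "(\<lambda>w. f w \<ominus>\<^bsub>K\<^esub> g w) \<in> carrier F" "ev (\<lambda>w. f w \<ominus>\<^bsub>K\<^esub> g w) = ev f \<ominus>\<^bsub>A\<^esub> ev g"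
proof -
  have "(\<lambda>w. f w \<ominus>\<^bsub>K\<^esub> g w) = (\<lambda>w. f w \<oplus>\<^bsub>K\<^esub> (\<ominus>\<^bsub>K\<^esub> \<one>\<^bsub>K\<^esub>) \<otimes>\<^bsub>K\<^esub> g w)"
    using assms(2) by (auto simp: free_algebra_carrier_iff a_minus_def K.l_minus)
  then show "(\<lambda>w. f w \<ominus>\<^bsub>K\<^esub> g w) \<in> carrier F" "ev (\<lambda>w. f w \<ominus>\<^bsub>K\<^esub> g w) = ev f \<ominus>\<^bsub>A\<^esub> ev g"
    using assms scale_closed[of "\<ominus>\<^bsub>K\<^esub> \<one>\<^bsub>K\<^esub>" g]
    by (simp_all add: K.free_algebra_add_closed ev_add ev_scale A.minus_eq smult_l_minus)
qed

text \<open>The residue of \<open>f\<close> forgets exactly the polynomials with coefficients in the maximal ideal,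
  and these evaluate exactly to \<open>m\<^sub>v \<Lambda>\<close>. So membership of \<open>ev f\<close> in \<open>m\<^sub>v \<Lambda>\<close> depends on the residue alone.\<close>

lemma ev_mem_m\<Lambda>_iff:
  assumes f: "f \<in> carrier (free_algebra (valuation_ring K v) I)"
  shows "ev f \<in> m\<Lambda> \<longleftrightarrow> coeff_residue K v f \<in> coeff_residue K v `
    ({r \<in> carrier F. ev r = \<zero>\<^bsub>A\<^esub>} \<inter> carrier (free_algebra (valuation_ring K v) I))"
proof
  have fF: "f \<in> carrier F" and fO: "f w \<in> K.integers" for w
    using f by (auto simp: K.free_algebra_valuation_ring)
  have fK: "f w \<in> carrier K" for w
    using fO by (simp add: K.integers_iff)
  show "coeff_residue K v f \<in> coeff_residue K v `
      ({r \<in> carrier F. ev r = \<zero>\<^bsub>A\<^esub>} \<inter> carrier (free_algebra (valuation_ring K v) I))" if "ev f \<in> m\<Lambda>"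
  proof -
    obtain h where h: "h \<in> carrier F" "\<And>w. h w \<in> K.nonunits" "ev f = ev h"
      using \<open>ev f \<in> m\<Lambda>\<close> by (auto elim!: latticeE)
    define r where "r = (\<lambda>w. f w \<ominus>\<^bsub>K\<^esub> h w)"
    have hK: "h w \<in> carrier K" for w
      using h(2) by (simp add: K.nonunits_iff)
    have r: "r \<in> carrier F" "ev r = \<zero>\<^bsub>A\<^esub>"
      using ev_diff[OF fF h(1)] ev_closed[OF h(1)] h(3) by (simp_all add: r_def A.minus_eq A.r_neg)
    have rO: "r w \<in> K.integers" for w
      using fO h(2) K.nonunits_subset unfolding r_def a_minus_def by (intro K.integers_closed) auto
    have "f w \<ominus>\<^bsub>K\<^esub> r w = h w" for w
      using fK hK by (simp add: r_def a_minus_def K.minus_add K.a_assoc[symmetric] K.r_neg)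
    then have "coeff_residue K v f = coeff_residue K v r"
      using K.coset_eq_iff[OF fO rO] h(2) by (auto simp: coeff_residue_def fun_eq_iff)
    then show ?thesis
      using r rO by (auto simp: K.free_algebra_valuation_ring)
  qed
  show "ev f \<in> m\<Lambda>" if mem: "coeff_residue K v f \<in> coeff_residue K v `
      ({r \<in> carrier F. ev r = \<zero>\<^bsub>A\<^esub>} \<inter> carrier (free_algebra (valuation_ring K v) I))"
  proof -
    obtain r where r: "r \<in> carrier F" "ev r = \<zero>\<^bsub>A\<^esub>" "\<And>w. r w \<in> K.integers"
      "coeff_residue K v f = coeff_residue K v r"
      using mem unfolding K.free_algebra_valuation_ring by blast
    have "f w \<ominus>\<^bsub>K\<^esub> r w \<in> K.nonunits" for w
      using fun_cong[OF r(4), of w] K.coset_eq_iff[OF fO r(3)] by (simp add: coeff_residue_def)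
    then have "ev (\<lambda>w. f w \<ominus>\<^bsub>K\<^esub> r w) \<in> m\<Lambda>"
      using ev_diff(1)[OF fF r(1)] by (intro latticeI)
    then show ?thesis
      using ev_diff(2)[OF fF r(1)] r(2) ev_closed[OF fF] by (simp add: A.minus_eq)
  qed
qed

lemma good_reduction_prime:
  assumes J: "ideal J (free_algebra (residue_field K v) I)"
    and good: "coeff_residue K v `
      ({r \<in> carrier F. ev r = \<zero>\<^bsub>A\<^esub>} \<inter> carrier (free_algebra (valuation_ring K v) I)) = J"
    and dom: "nc_domain (free_algebra (residue_field K v) I Quot J)"
  shows "nc_domain (A\<lparr>carrier := \<Lambda>\<rparr> Quot m\<Lambda>)"
  unfolding nc_domain_reduction_iff
proof (intro conjI ballI impI)
  let ?FO = "free_algebra (valuation_ring K v) I" and ?Fk = "free_algebra (residue_field K v) I"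
  interpret FO: ring ?FO
    using K.ring_valuation_ring by (rule ring.free_algebra_ring)
  have iff: "ev f \<in> m\<Lambda> \<longleftrightarrow> coeff_residue K v f \<in> J" if "f \<in> carrier ?FO" for f
    using ev_mem_m\<Lambda>_iff[OF that] good by simp
  have prime: "\<one>\<^bsub>?Fk\<^esub> \<notin> J"
    "\<And>x y. x \<in> carrier ?Fk \<Longrightarrow> y \<in> carrier ?Fk \<Longrightarrow> x \<otimes>\<^bsub>?Fk\<^esub> y \<in> J \<Longrightarrow> x \<in> J \<or> y \<in> J"
    using dom nc_domain_Quot_iff[OF J] by blast+
  note hom = K.coeff_residue_hom[of I]
  have "ev \<one>\<^bsub>?FO\<^esub> = \<one>\<^bsub>A\<^esub>"
    using ev_one by (simp cong: if_cong)
  then show "\<one>\<^bsub>A\<^esub> \<notin> m\<Lambda>"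
    using iff[OF FO.one_closed] ring_hom_one[OF hom] prime(1) by metis
  fix x y assume xy: "x \<in> \<Lambda>" "y \<in> \<Lambda>" "x \<otimes>\<^bsub>A\<^esub> y \<in> m\<Lambda>"
  obtain f g where f: "f \<in> carrier ?FO" "x = ev f" and g: "g \<in> carrier ?FO" "y = ev g"
    using xy(1,2) unfolding \<Lambda>_eq[symmetric] by blast
  have "f \<in> carrier F" "g \<in> carrier F"
    using f g by (simp_all add: K.free_algebra_valuation_ring)
  then have "ev (f \<otimes>\<^bsub>?FO\<^esub> g) \<in> m\<Lambda>"
    using xy(3) f g by (simp add: ev_mult K.free_algebra_valuation_ring_mult)
  then have "coeff_residue K v f \<otimes>\<^bsub>?Fk\<^esub> coeff_residue K v g \<in> J"
    using iff[OF FO.m_closed] ring_hom_mult[OF hom f(1) g(1)] f g by simp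
  then show "x \<in> m\<Lambda> \<or> y \<in> m\<Lambda>"
    using prime(2) ring_hom_closed[OF hom f(1)] ring_hom_closed[OF hom g(1)] iff f g by metis
qed

end

section \<open>Extending the valuation\<close>

context free_evaluation
begin

lemma finsum_smult_image:
  assumes "finite S" "\<And>s. s \<in> S \<Longrightarrow> c s \<in> carrier K \<and> x s \<in> ev ` carrier F"
  shows "(\<Oplus>\<^bsub>A\<^esub>s\<in>S. c s \<odot>\<^bsub>A\<^esub> x s) \<in> ev ` carrier F"
  using assms
proof (induction S rule: finite_induct)
  case empty
  interpret F: ring F
    by (rule K.free_algebra_ring)
  have "ev \<zero>\<^bsub>F\<^esub> = \<zero>\<^bsub>A\<^esub>"
    by (simp add: free_eval_def)
  then show ?case
    using F.zero_closed by (metis A.finsum_empty image_eqI)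
next
  case (insert s S)
  have x: "x t \<in> carrier A" "c t \<in> carrier K" if "t \<in> insert s S" for t
    using insert.prems[OF that] by auto
  obtain f where f: "f \<in> carrier F" "x s = ev f"
    using insert.prems by auto
  obtain g where g: "g \<in> carrier F" "(\<Oplus>\<^bsub>A\<^esub>s\<in>S. c s \<odot>\<^bsub>A\<^esub> x s) = ev g"
    using insert by auto
  have "(\<Oplus>\<^bsub>A\<^esub>s\<in>insert s S. c s \<odot>\<^bsub>A\<^esub> x s) = c s \<odot>\<^bsub>A\<^esub> x s \<oplus>\<^bsub>A\<^esub> (\<Oplus>\<^bsub>A\<^esub>s\<in>S. c s \<odot>\<^bsub>A\<^esub> x s)"
    using insert.hyps x by (intro A.finsum_insert) auto
  also have "\<dots> = ev (\<lambda>w. c s \<otimes>\<^bsub>K\<^esub> f w \<oplus>\<^bsub>K\<^esub> g w)"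
    using f g x by (simp add: ev_add ev_scale scale_closed)
  finally show ?case
    using f g x scale_closed by (auto intro!: image_eqI K.free_algebra_add_closed)
qed

lemma mult_image:
  assumes "x \<in> ev ` carrier F" "y \<in> ev ` carrier F"
  shows "x \<otimes>\<^bsub>A\<^esub> y \<in> ev ` carrier F"
proof -
  obtain f g where "f \<in> carrier F" "x = ev f" "g \<in> carrier F" "y = ev g"
    using assms by blast
  then show ?thesis
    using K.free_algebra_mult_closed ev_mult by (metis image_eqI)
qed

lemma word_image: "w \<in> lists I \<Longrightarrow> word w \<in> ev ` carrier F"
  using ev_monomial[of "\<one>\<^bsub>K\<^esub>" w] K.monomial_closed[of "\<one>\<^bsub>K\<^esub>" w I]
  by (metis K.one_closed image_eqI smult_one word_closed)

end

text \<open>An ordered monomial is a product of generators, so a PBW basis on elements in the image of the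
  evaluation makes the evaluation surjective.\<close>

lemma (in free_evaluation) PBW_generates:
  fixes b :: "nat \<Rightarrow> 'a"
  assumes PBW: "PBW_basis K A n b" and letters: "\<And>i. i \<in> {1..n} \<Longrightarrow> b i \<in> ev ` carrier F"
  shows "carrier A \<subseteq> ev ` carrier F"
proof
  have one: "\<one>\<^bsub>A\<^esub> \<in> ev ` carrier F"
    using word_image[of "[]"] by simp
  have pow: "b i [^]\<^bsub>A\<^esub> (k::nat) \<in> ev ` carrier F" if "i \<in> {1..n}" for i k
    using letters[OF that] by (induction k) (auto simp only: A.nat_pow_0 A.nat_pow_Suc intro: one mult_image)
  have foldr_mem: "foldr (\<lambda>i y. (b i [^]\<^bsub>A\<^esub> e i) \<otimes>\<^bsub>A\<^esub> y) is \<one>\<^bsub>A\<^esub> \<in> ev ` carrier F"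
    if "set is \<subseteq> {1..n}" for "is" and e :: "nat \<Rightarrow> nat"
    using that by (induction "is") (auto intro!: one mult_image pow)
  have mon: "ordered_monomial A n b e \<in> ev ` carrier F" for e
    unfolding ordered_monomial_def by (rule foldr_mem) auto
  fix x assume "x \<in> carrier A"
  then obtain c where "\<forall>e. c e \<in> carrier K" "finite {e. c e \<noteq> \<zero>\<^bsub>K\<^esub>}"
    "x = (\<Oplus>\<^bsub>A\<^esub>e\<in>{e. c e \<noteq> \<zero>\<^bsub>K\<^esub>}. c e \<odot>\<^bsub>A\<^esub> ordered_monomial A n b e)"
    using PBW unfolding PBW_basis_def basis_family_def by blast
  then show "x \<in> ev ` carrier F"
    using mon by (auto intro: finsum_smult_image)
qed

theorem theorem2p2:
  fixes K :: "'k ring"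
    and v :: "'k \<Rightarrow> 'g::linordered_ab_group_add with_infty"
    and A :: "('k, 'a) module"
    and G :: "nat \<Rightarrow> 'a set"
    and n :: nat
    and a :: "nat \<Rightarrow> 'a"
    and Q :: "'q ring"
    and \<iota> :: "'a \<Rightarrow> 'q"
  assumes "field K"
    and "ring_valuation K v"
    and "v ` carrier K = UNIV"
    and "nc_algebra K A"
    and "algebra_grading K A G"
    and "\<forall>i\<in>{1..n}. \<exists>m>0. a i \<in> G m"
    and "PBW_basis K A n a"
    and "classical_ring_of_fractions A Q \<iota>"
  shows "(nc_domain (Lambda_bar K v A n a) \<and> ore_domain A \<longrightarrow> valuation_extends K v A Q \<iota>) \<and>
    (\<forall>d p. normalized_relations K v A n a d p \<and> good_reduction K v A n a d p \<and>
       nc_domain (residue_algebra K v n d p) \<and> ore_domain A \<longrightarrow> valuation_extends K v A Q \<iota>)"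
proof -
  obtain \<delta> where \<delta>: "\<And>i. i \<in> {1..n} \<Longrightarrow> 0 < \<delta> i \<and> a i \<in> G (\<delta> i)"
    using assms(6) by metis
  interpret K: field K by fact
  interpret A: ring A using assms(4) by (simp add: nc_algebra_def)
  interpret module K A using assms(4) by (simp add: nc_algebra_def)
  interpret valued_evaluation K v A a "{1..n}"
    using assms(2,4,7) by unfold_locales (auto simp: nc_algebra_def PBW_basis_def)
  interpret graded_evaluation K A a "{1..n}" G \<delta>
    using assms(5) \<delta> by unfold_locales auto
  have "a i \<in> ev ` carrier F" if "i \<in> {1..n}" for i
  proof -
    have "a i \<in> carrier A"
      using letters that by auto
    then show ?thesis
      using word_image[of "[i]"] that by simp
  qed
  then have generated: "carrier A \<subseteq> ev ` carrier F"
    using assms(7) by (intro PBW_generates)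
  have reduction: "Lambda_bar K v A n a = A\<lparr>carrier := \<Lambda>\<rparr> Quot m\<Lambda>"
  proof -
    have "Lambda_ring K v A n a = A\<lparr>carrier := \<Lambda>\<rparr>"
      by (simp only: Lambda_ring_def \<Lambda>_eq)
    moreover from this have "max_ideal_Lambda K v A n a = m\<Lambda>"
      using generate_eq_m\<Lambda> by (simp add: max_ideal_Lambda_def del: One_nat_def)
    ultimately show ?thesis
      by (simp only: Lambda_bar_def)
  qed
  have extends: "valuation_extends K v A Q \<iota>"
    if dom: "nc_domain (Lambda_bar K v A n a)" and ore: "ore_domain A"
  proof -
    have prime: "\<one>\<^bsub>A\<^esub> \<notin> m\<Lambda> \<and> (\<forall>x\<in>\<Lambda>. \<forall>y\<in>\<Lambda>. x \<otimes>\<^bsub>A\<^esub> y \<in> m\<Lambda> \<longrightarrow> x \<in> m\<Lambda> \<or> y \<in> m\<Lambda>)"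
      using dom unfolding reduction nc_domain_reduction_iff .
    interpret gauss_valuation K v A a "{1..n}" G \<delta>
      using generated prime by unfold_locales blast+
    interpret Q: ring Q
      using assms(8) unfolding classical_ring_of_fractions_def by blast
    interpret valued_fractions A Q \<iota> gauss
      using assms(8) ore ring_valuation_gauss by unfold_locales
    obtain w where "ring_valuation Q w" "\<forall>x\<in>carrier A. w (\<iota> x) = gauss x"
      using ex_fraction_valuation by blast
    moreover from this have "w (\<iota> (c \<odot>\<^bsub>A\<^esub> \<one>\<^bsub>A\<^esub>)) = v c" if "c \<in> carrier K" for c
      using gauss_scalar[OF that] smult_closed[OF that A.one_closed] by (simp del: One_nat_def)
    ultimately show ?thesis
      unfolding valuation_extends_def by blast
  qed
  have "nc_domain (Lambda_bar K v A n a)"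
    if "normalized_relations K v A n a d p" "good_reduction K v A n a d p"
      "nc_domain (residue_algebra K v n d p)" for d p
  proof -
    let ?Fk = "free_algebra (residue_field K v) {1..n}"
    have "(\<lambda>i. coeff_residue K v (p i)) ` {1..d} \<subseteq> carrier ?Fk"
      using that(1) ring_hom_closed[OF K.coeff_residue_hom]
      unfolding normalized_relations_def by blast
    then have "ideal (reduced_relations K v n d p) ?Fk"
      unfolding reduced_relations_def
      by (intro ring.genideal_ideal ring.free_algebra_ring K.ring_residue_field)
    moreover have "relation_ideal K A n a = {r \<in> carrier F. ev r = \<zero>\<^bsub>A\<^esub>}"
      by (simp add: relation_ideal_def a_kernel_def kernel_def)
    ultimately show ?thesis
      unfolding reduction using that(2,3)
      by (intro good_reduction_prime) (auto simp: good_reduction_def residue_algebra_def)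
  qed
  then show ?thesis
    using extends by blast
qed

end
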